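(* Let $r$ be a positive real number. For each positive integer $d$ let $P_d(r) = \left\{ \sum_{j=0}^d a_j x^j \in \mathbb{R}[x] : |a_j| \le r,\ 0\le j\le d \right\} \simeq [-r,r]^{d+1}$, equipped with the uniform probability distribution. Then the probability that $f \in P_d(r)$ is g-convex with respect to some connection on $\mathbb{R}$ is $O(1/\log d)$ (as $d\to\infty$).
   Context: A connection means a smooth torsion-free affine connection $\nabla$ ($\nabla_XY-\nabla_YX=[X,Y]$). A smooth function $f$ on a manifold $\mathcal{M}$ is g-convex with respect to $\nabla$ if $f\circ\gamma:[0,1]\to\mathbb{R}$ is convex for every $\nabla$-geodesic $\gamma:[0,1]\to\mathcal{M}$; equivalently, $\mathrm{Hess}_\nabla f(X,Y)=X(Y(f))-(\nabla_XY)(f)$ is positive semidefinite at every point. *)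

theory Defs
  imports "HOL-Probability.Probability" "HOL-Computational_Algebra.Polynomial"
    "HOL-Library.Landau_Symbols"
begin

definition smooth_fun :: "(real \<Rightarrow> real) \<Rightarrow> bool" where
  "smooth_fun f \<longleftrightarrow> (\<forall>n x. (deriv ^^ n) f differentiable (at x))"

text \<open>
  A smooth vector field \<open>X \<partial>\<close> on the manifold \<open>\<real>\<close> is identified with its coefficient
  function \<open>X\<close> with respect to the global coordinate field \<open>\<partial> = d/dx\<close>.
\<close>

definition vf_apply :: "(real \<Rightarrow> real) \<Rightarrow> (real \<Rightarrow> real) \<Rightarrow> real \<Rightarrow> real" where
  "vf_apply X f = (\<lambda>x. X x * deriv f x)"

text \<open>The coefficient function of the commutator of the derivations \<open>X \<partial>\<close> and \<open>Y \<partial>\<close>.\<close>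

definition lie_bracket :: "(real \<Rightarrow> real) \<Rightarrow> (real \<Rightarrow> real) \<Rightarrow> real \<Rightarrow> real" where
  "lie_bracket X Y = (\<lambda>x. vf_apply X Y x - vf_apply Y X x)"

text \<open>
  Smooth torsion-free affine connections on \<open>\<real>\<close>; \<open>nabla X Y\<close> is \<open>\<nabla>\<^sub>X Y\<close>. Its values on
  non-smooth arguments are irrelevant. Homogeneity over \<open>\<real>\<close> in \<open>Y\<close> is the case of constant \<open>f\<close>
  in \<open>leibniz\<close>.
\<close>

locale connection =
  fixes nabla :: "(real \<Rightarrow> real) \<Rightarrow> (real \<Rightarrow> real) \<Rightarrow> real \<Rightarrow> real"
  assumes smooth: "smooth_fun X \<Longrightarrow> smooth_fun Y \<Longrightarrow> smooth_fun (nabla X Y)"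
    and add_left: "smooth_fun X \<Longrightarrow> smooth_fun X' \<Longrightarrow> smooth_fun Y \<Longrightarrow>
          nabla (\<lambda>x. X x + X' x) Y = (\<lambda>x. nabla X Y x + nabla X' Y x)"
    and scale_left: "smooth_fun f \<Longrightarrow> smooth_fun X \<Longrightarrow> smooth_fun Y \<Longrightarrow>
          nabla (\<lambda>x. f x * X x) Y = (\<lambda>x. f x * nabla X Y x)"
    and add_right: "smooth_fun X \<Longrightarrow> smooth_fun Y \<Longrightarrow> smooth_fun Y' \<Longrightarrow>
          nabla X (\<lambda>x. Y x + Y' x) = (\<lambda>x. nabla X Y x + nabla X Y' x)"
    and leibniz: "smooth_fun f \<Longrightarrow> smooth_fun X \<Longrightarrow> smooth_fun Y \<Longrightarrow>
          nabla X (\<lambda>x. f x * Y x) = (\<lambda>x. f x * nabla X Y x + vf_apply X f x * Y x)"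
    and torsion_free: "smooth_fun X \<Longrightarrow> smooth_fun Y \<Longrightarrow>
          (\<lambda>x. nabla X Y x - nabla Y X x) = lie_bracket X Y"

text \<open>The Christoffel symbol, defined by \<open>\<nabla>\<^sub>\<partial> \<partial> = \<Gamma> \<partial>\<close>.\<close>

definition christoffel ::
  "((real \<Rightarrow> real) \<Rightarrow> (real \<Rightarrow> real) \<Rightarrow> real \<Rightarrow> real) \<Rightarrow> real \<Rightarrow> real" where
  "christoffel nabla = nabla (\<lambda>_. 1) (\<lambda>_. 1)"

text \<open>
  Geodesics parametrised by \<open>[0,1]\<close>: the covariant derivative \<open>v' + \<Gamma>(\<gamma>) v\<^sup>2\<close> of the velocity
  \<open>v = \<gamma>'\<close> along \<open>\<gamma>\<close> vanishes. Derivatives at the endpoints are one-sided; since \<open>\<Gamma>\<close> is smooth,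
  every solution is automatically smooth.
\<close>

definition geodesic ::
  "((real \<Rightarrow> real) \<Rightarrow> (real \<Rightarrow> real) \<Rightarrow> real \<Rightarrow> real) \<Rightarrow> (real \<Rightarrow> real) \<Rightarrow> bool" where
  "geodesic nabla \<gamma> \<longleftrightarrow>
     (\<exists>v. \<forall>t\<in>{0..1}.
        (\<gamma> has_real_derivative v t) (at t within {0..1}) \<and>
        (v has_real_derivative - (christoffel nabla (\<gamma> t) * (v t)\<^sup>2)) (at t within {0..1}))"

definition g_convex ::
  "((real \<Rightarrow> real) \<Rightarrow> (real \<Rightarrow> real) \<Rightarrow> real \<Rightarrow> real) \<Rightarrow> (real \<Rightarrow> real) \<Rightarrow> bool" where
  "g_convex nabla f \<longleftrightarrow> (\<forall>\<gamma>. geodesic nabla \<gamma> \<longrightarrow> convex_on {0..1} (f \<circ> \<gamma>))"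

text \<open>
  The coefficient box \<open>[-r,r]\<^sup>d\<^sup>+\<^sup>1\<close>, whose points are extensional functions on \<open>{..d}\<close>, with its
  uniform distribution, i.e. normalised Lebesgue measure on \<open>\<real>\<^sup>d\<^sup>+\<^sup>1\<close> restricted to the box.
\<close>

definition coeff_box :: "nat \<Rightarrow> real \<Rightarrow> (nat \<Rightarrow> real) set" where
  "coeff_box d r = {..d} \<rightarrow>\<^sub>E {-r..r}"

definition coeff_distr :: "nat \<Rightarrow> real \<Rightarrow> (nat \<Rightarrow> real) measure" where
  "coeff_distr d r = uniform_measure (Pi\<^sub>M {..d} (\<lambda>_. lborel)) (coeff_box d r)"

definition coeff_poly :: "nat \<Rightarrow> (nat \<Rightarrow> real) \<Rightarrow> real poly" where
  "coeff_poly d a = (\<Sum>j\<le>d. monom (a j) j)"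

text \<open>
  Statements about the probability of this event should also assert its measurability, because
  \<^const>\<open>measure\<close> is \<open>0\<close> on non-measurable sets.
\<close>

definition g_convexifiable :: "nat \<Rightarrow> real \<Rightarrow> (nat \<Rightarrow> real) set" where
  "g_convexifiable d r =
     {a \<in> coeff_box d r. \<exists>nabla. connection nabla \<and> g_convex nabla (poly (coeff_poly d a))}"

end

theory Submission
  imports Defs
begin

text \<open>
  On the line, the coordinate \<open>\<phi>\<close> with \<open>\<phi>' = exp (\<integral>\<Gamma>)\<close> makes every geodesic affine, so a g-convex
  function is a convex function of \<open>\<phi>\<close> and the sign of its derivative is nondecreasing. For
  polynomials the converse holds: if \<open>f' = (x - x\<^sub>0)\<^sup>k q\<close> with \<open>q\<close> free of zeros, then
  \<open>\<Gamma> = q'/q\<close> gives \<open>f'' - \<Gamma> f' = k (x - x\<^sub>0)\<^sup>k\<^sup>-\<^sup>1 q \<ge> 0\<close>.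

  Hence for a g-convexifiable random \<open>f\<close> the values of \<open>f'\<close> at \<open>1 - 4\<^sup>-\<^sup>k\<close> have a constant sign for
  \<open>1 \<le> k \<le> n\<close> or for \<open>n < k \<le> 2n\<close>, where \<open>16\<^sup>n \<le> d\<close>. Let \<open>Y\<^sub>k\<close> be these values, normalised to
  have variance of order 1; their correlations are bounded by multiples of \<open>8\<^sup>-\<^sup>|\<^sup>k\<^sup>-\<^sup>l\<^sup>|\<close>. A constant sign
  forces \<open>|\<Sum>Y\<^sub>k| = \<Sum>|Y\<^sub>k| \<ge> \<Sum>(1 - cos Y\<^sub>k)\<close>. Both sums over \<open>n\<close> indices have variance \<open>O(n)\<close>: for
  the cosines, because the characteristic functions factor over the independent coefficients and
  the covariance is controlled by the correlation. Since the right-hand side has mean at least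
  \<open>c n\<close>, Chebyshev's inequality bounds the probability by \<open>O(1/n) = O(1/log d)\<close>.
\<close>

section \<open>Smooth functions and connections on the line\<close>

text \<open>Any class of differentiable functions closed under \<open>deriv\<close> consists of
  smooth functions. Smoothness then needs only the shape of one derivative, never a formula for the
  n-th.\<close>

lemma smooth_fun_coinduct:
  assumes "P f"
    and diff: "\<And>f x. P f \<Longrightarrow> f differentiable (at x)"
    and step: "\<And>f. P f \<Longrightarrow> P (deriv f)"
  shows "smooth_fun f"
proof -
  have "P ((deriv ^^ n) f)" for n
    by (induction n) (simp_all add: assms)
  then show ?thesis
    by (simp add: smooth_fun_def diff)
qed

lemma smooth_fun_DERIV:
  assumes "smooth_fun f"
  shows "(f has_real_derivative deriv f x) (at x)"
  using assms[unfolded smooth_fun_def, rule_format, of 0 x]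
  by (simp add: DERIV_deriv_iff_real_differentiable)

lemma smooth_fun_differentiable: "smooth_fun f \<Longrightarrow> f differentiable (at x)"
  using smooth_fun_DERIV real_differentiable_def by blast

lemma smooth_fun_isCont: "smooth_fun f \<Longrightarrow> isCont f x"
  using smooth_fun_DERIV DERIV_isCont by blast

lemma smooth_fun_deriv: "smooth_fun f \<Longrightarrow> smooth_fun (deriv f)"
  unfolding smooth_fun_def by (metis comp_apply funpow_Suc_right)

lemma deriv_add_fun:
  assumes "\<And>x. (f::real \<Rightarrow> real) differentiable (at x)" "\<And>x. g differentiable (at x)"
  shows "deriv (\<lambda>x. f x + g x) = (\<lambda>x. deriv f x + deriv g x)"
  using assms
  by (intro ext DERIV_imp_deriv DERIV_add) (simp_all add: DERIV_deriv_iff_real_differentiable)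

lemma deriv_mult_fun:
  assumes "smooth_fun f" "smooth_fun g"
  shows "deriv (\<lambda>x. f x * g x) = (\<lambda>x. f x * deriv g x + deriv f x * g x)"
proof
  fix x
  show "deriv (\<lambda>x. f x * g x) x = f x * deriv g x + deriv f x * g x"
    using DERIV_mult[OF smooth_fun_DERIV[OF assms(1), of x] smooth_fun_DERIV[OF assms(2), of x]]
    by (simp add: DERIV_imp_deriv algebra_simps)
qed

lemma smooth_fun_add:
  assumes "smooth_fun f" "smooth_fun g"
  shows "smooth_fun (\<lambda>x. f x + g x)"
proof (rule smooth_fun_coinduct)
  let ?P = "\<lambda>h. \<exists>f g. smooth_fun f \<and> smooth_fun g \<and> h = (\<lambda>x. f x + g x)"
  show "?P (\<lambda>x. f x + g x)"
    using assms by blast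
  show "h differentiable (at x)" if "?P h" for h x
    using that smooth_fun_differentiable differentiable_add by blast
  show "?P (deriv h)" if h: "?P h" for h
  proof -
    obtain f g where fg: "smooth_fun f" "smooth_fun g" "h = (\<lambda>x. f x + g x)"
      using h by blast
    then have "deriv h = (\<lambda>x. deriv f x + deriv g x)"
      by (simp add: deriv_add_fun smooth_fun_differentiable)
    with fg show ?thesis
      using smooth_fun_deriv by blast
  qed
qed

text \<open>Products alone are not closed under \<open>deriv\<close>, since the Leibniz rule
  produces sums; this is the closed class to which \<open>smooth_fun_coinduct\<close>
  applies.\<close>

inductive product_span :: "(real \<Rightarrow> real) \<Rightarrow> bool" where
  mult: "smooth_fun f \<Longrightarrow> smooth_fun g \<Longrightarrow> product_span (\<lambda>x. f x * g x)"
| add: "product_span f \<Longrightarrow> product_span g \<Longrightarrow> product_span (\<lambda>x. f x + g x)"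

lemma product_span_differentiable: "product_span f \<Longrightarrow> f differentiable (at x)"
proof (induction rule: product_span.induct)
  case (mult f g)
  then show ?case
    by (intro differentiable_mult smooth_fun_differentiable)
qed (auto intro!: derivative_intros)

lemma product_span_deriv: "product_span f \<Longrightarrow> product_span (deriv f)"
proof (induction rule: product_span.induct)
  case (mult f g)
  then show ?case
    by (auto simp: deriv_mult_fun intro!: product_span.intros smooth_fun_deriv)
next
  case (add f g)
  then show ?case
    by (simp add: deriv_add_fun product_span_differentiable product_span.add)
qed

lemma smooth_fun_mult:
  assumes "smooth_fun f" "smooth_fun g"
  shows "smooth_fun (\<lambda>x. f x * g x)"
  using product_span.mult[OF assms] product_span_differentiable product_span_deriv
  by (rule smooth_fun_coinduct)

text \<open>The derivative of a polynomial over a power of \<open>q\<close> is again of this form,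
  so these fractions are a class closed under \<open>deriv\<close>.\<close>

lemma smooth_fun_poly_quotient:
  fixes p q :: "real poly"
  assumes q: "\<And>x. poly q x \<noteq> 0"
  shows "smooth_fun (\<lambda>x. poly p x / poly q x)"
proof (rule smooth_fun_coinduct)
  let ?P = "\<lambda>h. \<exists>p n. h = (\<lambda>x. poly p x / poly q x ^ Suc n)"
  show "?P (\<lambda>x. poly p x / poly q x)"
    by (intro exI[of _ p] exI[of _ 0]) simp
  have D: "((\<lambda>x. poly p x / poly q x ^ Suc n) has_real_derivative
      poly (pderiv p * q - of_nat (Suc n) * p * pderiv q) x / poly q x ^ Suc (Suc n)) (at x)" for p n x
    by (rule derivative_eq_intros poly_DERIV power_not_zero q refl)+
       (use q[of x] in \<open>simp add: field_simps\<close>)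
  show "h differentiable (at x)" if "?P h" for h x
    using that D real_differentiable_def by blast
  show "?P (deriv h)" if "?P h" for h
    using that D DERIV_imp_deriv by (metis (no_types, lifting) ext)
qed

lemma smooth_fun_const: "smooth_fun (\<lambda>_. c)"
  using smooth_fun_poly_quotient[of 1 "[:c:]"] by simp

text \<open>The coordinate formula with a prescribed Christoffel symbol. It allows
  \<open>\<Gamma>\<close> to be any smooth function, which is the freedom used to convexify a
  polynomial.\<close>

definition gamma_connection ::
  "(real \<Rightarrow> real) \<Rightarrow> (real \<Rightarrow> real) \<Rightarrow> (real \<Rightarrow> real) \<Rightarrow> real \<Rightarrow> real" where
  "gamma_connection \<Gamma> X Y = (\<lambda>x. X x * (deriv Y x + \<Gamma> x * Y x))"

lemma connection_gamma_connection:
  assumes "smooth_fun \<Gamma>"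
  shows "connection (gamma_connection \<Gamma>)"
proof
  show "smooth_fun (gamma_connection \<Gamma> X Y)" if "smooth_fun X" "smooth_fun Y" for X Y
    unfolding gamma_connection_def
    by (intro smooth_fun_add smooth_fun_mult smooth_fun_deriv assms that)
next
  fix X Y Y' :: "real \<Rightarrow> real"
  assume "smooth_fun X" "smooth_fun Y" "smooth_fun Y'"
  then have "deriv (\<lambda>x. Y x + Y' x) = (\<lambda>x. deriv Y x + deriv Y' x)"
    by (simp add: deriv_add_fun smooth_fun_differentiable)
  then show "gamma_connection \<Gamma> X (\<lambda>x. Y x + Y' x) =
      (\<lambda>x. gamma_connection \<Gamma> X Y x + gamma_connection \<Gamma> X Y' x)"
    by (simp add: gamma_connection_def algebra_simps)
qed (simp_all add: gamma_connection_def deriv_mult_fun vf_apply_def lie_bracket_def algebra_simps)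

lemma christoffel_gamma_connection: "christoffel (gamma_connection \<Gamma>) = \<Gamma>"
  by (simp add: christoffel_def gamma_connection_def)

section \<open>g-convex polynomials\<close>

text \<open>One-sided derivatives at the endpoints match those in \<open>geodesic\<close>. The mean
  value theorem is used twice: \<open>h'\<close> is nondecreasing, hence the graph lies above its
  tangents.\<close>

lemma convex_on_Icc_if_DERIV2_nonneg:
  fixes h h' h'' :: "real \<Rightarrow> real"
  assumes h: "\<And>t. t \<in> {a..b} \<Longrightarrow> (h has_real_derivative h' t) (at t within {a..b})"
    and h': "\<And>t. t \<in> {a..b} \<Longrightarrow> (h' has_real_derivative h'' t) (at t within {a..b})"
    and nonneg: "\<And>t. t \<in> {a..b} \<Longrightarrow> 0 \<le> h'' t"
  shows "convex_on {a..b} h"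
proof (rule pos_convex_function)
  have mvt: "\<exists>c\<in>{s..t}. g t - g s = g' c * (t - s)"
    if g: "\<And>t. t \<in> {a..b} \<Longrightarrow> (g has_real_derivative g' t) (at t within {a..b})"
      and st: "a \<le> s" "s \<le> t" "t \<le> b" for g g' :: "real \<Rightarrow> real" and s t
  proof (rule mvt_very_simple[OF st(2)])
    show "(g has_derivative (*) (g' x)) (at x within {s..t})" if "s \<le> x" "x \<le> t" for x
      unfolding has_field_derivative_def[symmetric]
      by (rule DERIV_subset[OF g]) (use that st in auto)
  qed
  have mono: "h' s \<le> h' t" if st: "a \<le> s" "s \<le> t" "t \<le> b" for s t
  proof -
    obtain c where c: "s \<le> c" "c \<le> t" "h' t - h' s = h'' c * (t - s)"
      using mvt[of h' h'' s t, OF h' st] unfolding Bex_def atLeastAtMost_iff by blast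
    have "0 \<le> h'' c * (t - s)"
      using nonneg[of c] c(1,2) st by (intro mult_nonneg_nonneg) auto
    with c(3) show ?thesis by simp
  qed
  show "h' x * (y - x) \<le> h y - h x" if xy: "x \<in> {a..b}" "y \<in> {a..b}" for x y
  proof (cases "x \<le> y")
    case True
    obtain c where c: "x \<le> c" "c \<le> y" "h y - h x = h' c * (y - x)"
      using mvt[of h h' x y, OF h] xy True unfolding Bex_def atLeastAtMost_iff by blast
    then show ?thesis
      using mono[of x c] xy True by (auto intro!: mult_right_mono)
  next
    case False
    obtain c where c: "y \<le> c" "c \<le> x" "h x - h y = h' c * (x - y)"
      using mvt[of h h' y x, OF h] xy False unfolding Bex_def atLeastAtMost_iff by (meson linear)
    have "h' c * (x - y) \<le> h' x * (x - y)"
      using mono[of c x] xy c False by (auto intro!: mult_right_mono)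
    with c(3) show ?thesis by (simp add: algebra_simps)
  qed
qed simp

text \<open>With \<open>G' = \<Gamma>\<close> and \<open>\<phi>' = exp G\<close>, the geodesic
  equation says that \<open>\<phi> \<circ> \<gamma>\<close> is affine. So the geodesic is the
  preimage under \<open>\<phi>\<close> of the segment from \<open>\<phi> a\<close> to
  \<open>\<phi> b\<close>.\<close>

lemma geodesic_through_interval:
  fixes \<Gamma> :: "real \<Rightarrow> real"
  assumes \<Gamma>: "\<And>x. isCont \<Gamma> x" "christoffel nabla = \<Gamma>" and "a < b"
  obtains \<gamma> v where "geodesic nabla \<gamma>"
    "\<And>t. t \<in> {0..1} \<Longrightarrow> (\<gamma> has_real_derivative v t) (at t within {0..1})"
    "\<And>t. t \<in> {0..1} \<Longrightarrow> 0 < v t" "\<gamma> 0 = a" "\<gamma> 1 = b"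
proof -
  obtain G where G: "\<And>x. (G has_real_derivative \<Gamma> x) (at x)"
    using einterval_antiderivative[of "-\<infinity>" \<infinity> \<Gamma>] \<Gamma>(1)
    by (auto simp: has_real_derivative_iff_has_vector_derivative)
  have "isCont (\<lambda>x. exp (G x)) x" for x
    using G by (intro continuous_intros) (rule DERIV_isCont)
  then obtain \<phi> where \<phi>: "\<And>x. (\<phi> has_real_derivative exp (G x)) (at x)"
    using einterval_antiderivative[of "-\<infinity>" \<infinity> "\<lambda>x. exp (G x)"]
    by (auto simp: has_real_derivative_iff_has_vector_derivative)
  have cont: "isCont \<phi> x" for x
    using \<phi> by (rule DERIV_isCont)
  have mono: "\<phi> x < \<phi> y" if "x < y" for x y
    using DERIV_pos_imp_increasing[OF that] \<phi> exp_gt_zero by blast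
  then have inj: "inj \<phi>"
    by (metis injI less_irrefl linorder_neqE)
  define \<psi> where "\<psi> = inv \<phi>"
  have \<psi>\<phi>: "\<psi> (\<phi> x) = x" for x
    using inj by (simp add: \<psi>_def)
  \<comment> \<open>The range of \<open>\<phi>\<close> may be bounded, so the inverse is
    differentiated only there; the segment stays in the range by the intermediate value
    theorem.\<close>
  have \<psi>': "(\<psi> has_real_derivative inverse (exp (G (\<psi> y)))) (at y)" if y: "y \<in> range \<phi>" for y
  proof -
    obtain x where "y = \<phi> x" using y by blast
    moreover have "(\<psi> has_derivative (*) (inverse (exp (G x)))) (at (\<phi> x))"
    proof (rule has_derivative_inverse_strong[where S=UNIV and f=\<phi> and x=x and f'="(*) (exp (G x))"])
      show "(\<phi> has_derivative (*) (exp (G x))) (at x)"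
        using \<phi>[of x] by (simp add: has_field_derivative_def)
      show "continuous_on UNIV \<phi>"
        using cont by (simp add: continuous_at_imp_continuous_on)
      show "(*) (exp (G x)) \<circ> (*) (inverse (exp (G x))) = id"
        by (simp add: fun_eq_iff)
    qed (simp_all add: \<psi>\<phi>)
    ultimately show ?thesis
      by (simp add: has_field_derivative_def \<psi>\<phi>)
  qed
  define \<beta> where "\<beta> = \<phi> b - \<phi> a"
  have "0 < \<beta>" using mono[OF \<open>a < b\<close>] by (simp add: \<beta>_def)
  have line: "\<phi> a + \<beta> * t \<in> range \<phi>" if "t \<in> {0..1}" for t
  proof -
    have "\<beta> * t \<le> \<beta>"
      using that \<open>0 < \<beta>\<close> by (simp add: mult_left_le)
    moreover have "0 \<le> \<beta> * t" "\<phi> b = \<phi> a + \<beta>"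
      using that \<open>0 < \<beta>\<close> by (simp_all add: \<beta>_def)
    ultimately have "\<phi> a \<le> \<phi> a + \<beta> * t" "\<phi> a + \<beta> * t \<le> \<phi> b"
      by linarith+
    then obtain x where "\<phi> x = \<phi> a + \<beta> * t"
      using IVT[of \<phi> a "\<phi> a + \<beta> * t" b] cont \<open>a < b\<close> by auto
    then show ?thesis by (metis rangeI)
  qed
  define \<gamma> where "\<gamma> t = \<psi> (\<phi> a + \<beta> * t)" for t
  define v where "v t = \<beta> * exp (- G (\<gamma> t))" for t
  have \<gamma>': "(\<gamma> has_real_derivative v t) (at t)" if "t \<in> {0..1}" for t
  proof -
    have "((\<lambda>t. \<phi> a + \<beta> * t) has_real_derivative \<beta>) (at t)"
      by (auto intro!: derivative_eq_intros)
    from DERIV_chain2[where f=\<psi> and g="\<lambda>t. \<phi> a + \<beta> * t", OF \<psi>'[OF line[OF that]] this]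
    show ?thesis
      unfolding \<gamma>_def v_def by (simp add: exp_minus mult.commute)
  qed
  have v': "(v has_real_derivative - (\<Gamma> (\<gamma> t) * (v t)\<^sup>2)) (at t)" if "t \<in> {0..1}" for t
  proof -
    have "((\<lambda>t. G (\<gamma> t)) has_real_derivative \<Gamma> (\<gamma> t) * v t) (at t)"
      by (rule DERIV_chain2[where f=G and g=\<gamma>, OF G \<gamma>'[OF that]])
    from DERIV_cmult[OF DERIV_fun_exp[OF DERIV_minus[OF this]], of \<beta>] show ?thesis
      unfolding v_def[abs_def] by (simp add: power2_eq_square mult_ac)
  qed
  show thesis
  proof (rule that)
    show "geodesic nabla \<gamma>"
      unfolding geodesic_def \<Gamma>(2) using \<gamma>' v' has_field_derivative_at_within by blast
    show "(\<gamma> has_real_derivative v t) (at t within {0..1})" if "t \<in> {0..1}" for t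
      using \<gamma>'[OF that] by (rule has_field_derivative_at_within)
  qed (use \<open>0 < \<beta>\<close> in \<open>simp_all add: v_def \<gamma>_def \<psi>\<phi> \<beta>_def\<close>)
qed

lemma sgn_le_sgn_if_mult_le:
  fixes p q v w :: real
  assumes "p * v \<le> q * w" "0 < v" "0 < w"
  shows "sgn p \<le> sgn q"
proof -
  have "sgn (p * v) \<le> sgn (q * w)"
    using assms(1) by (auto simp: sgn_if)
  then show ?thesis
    using assms(2,3) by (simp add: sgn_mult)
qed

text \<open>Along an increasing geodesic through both points, convexity orders the products
  \<open>f' * v\<close>, and the positive velocities do not change signs.\<close>

lemma g_convex_imp_mono_sgn:
  assumes "connection nabla" "g_convex nabla f"
    and f': "\<And>x. (f has_real_derivative f' x) (at x)"
  shows "mono (\<lambda>x. sgn (f' x))"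
proof (rule monoI)
  fix x y :: real
  assume "x \<le> y"
  show "sgn (f' x) \<le> sgn (f' y)"
  proof (cases "x = y")
    case False
    have "smooth_fun (christoffel nabla)"
      unfolding christoffel_def by (intro connection.smooth[OF assms(1)] smooth_fun_const)
    \<comment> \<open>The geodesic overshoots by 1 on both sides so that \<open>x\<close> and
      \<open>y\<close> are passed at interior times, where the tangent inequality is
      available.\<close>
    then obtain \<gamma> v where \<gamma>: "geodesic nabla \<gamma>"
      "\<And>t. t \<in> {0..1} \<Longrightarrow> (\<gamma> has_real_derivative v t) (at t within {0..1})"
      "\<And>t. t \<in> {0..1} \<Longrightarrow> 0 < v t" "\<gamma> 0 = x - 1" "\<gamma> 1 = y + 1"
      using geodesic_through_interval[OF smooth_fun_isCont refl, of nabla "x - 1" "y + 1"] \<open>x \<le> y\<close>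
      by auto
    have cont: "continuous_on {0..1} \<gamma>"
      using \<gamma>(2) by (meson DERIV_continuous continuous_on_eq_continuous_within)
    have conv: "convex_on {0..1} (f \<circ> \<gamma>)"
      using assms(2) \<gamma>(1) by (auto simp: g_convex_def)
    obtain s where s: "0 \<le> s" "s \<le> 1" "\<gamma> s = x"
      using IVT'[of \<gamma> 0 x 1] cont \<gamma>(4,5) \<open>x \<le> y\<close> by auto
    obtain t where t: "s \<le> t" "t \<le> 1" "\<gamma> t = y"
      using IVT'[of \<gamma> s y 1] continuous_on_subset[OF cont, of "{s..1}"] \<gamma>(4,5) \<open>x \<le> y\<close> s by auto
    have st: "0 < s" "s < t" "t < 1"
      using s t \<gamma>(4,5) False by (auto simp: order.order_iff_strict)
    have D: "((f \<circ> \<gamma>) has_real_derivative f' (\<gamma> u) * v u) (at u within {0..1})" if "u \<in> {0..1}" for u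
      using DERIV_chain[OF f' \<gamma>(2)[OF that]] .
    have "f y - f x \<ge> f' x * v s * (t - s)"
      using convex_on_imp_above_tangent[OF conv _ _ _ D, of s t] s t st by auto
    moreover have "f x - f y \<ge> f' y * v t * (s - t)"
      using convex_on_imp_above_tangent[OF conv _ _ _ D, of t s] s t st by auto
    ultimately have "(f' x * v s) * (t - s) \<le> (f' y * v t) * (t - s)"
      by (simp add: algebra_simps)
    then have "f' x * v s \<le> f' y * v t"
      using st by simp
    moreover have "0 < v s" "0 < v t"
      using \<gamma>(3) s t by auto
    ultimately show ?thesis
      by (rule sgn_le_sgn_if_mult_le)
  qed simp
qed

text \<open>The geodesic equation replaces \<open>v'\<close> in the second derivative of
  \<open>f \<circ> \<gamma>\<close>, which becomes the Hessian times \<open>v^2\<close>.\<close>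

lemma convex_Hessian_imp_g_convex:
  assumes f: "\<And>x. (f has_real_derivative f' x) (at x)" "\<And>x. (f' has_real_derivative f'' x) (at x)"
    and hess: "\<And>x. 0 \<le> f'' x - christoffel nabla x * f' x"
  shows "g_convex nabla f"
  unfolding g_convex_def
proof (intro allI impI)
  fix \<gamma>
  assume "geodesic nabla \<gamma>"
  then obtain v where v:
    "\<And>t. t \<in> {0..1} \<Longrightarrow> (\<gamma> has_real_derivative v t) (at t within {0..1})"
    "\<And>t. t \<in> {0..1} \<Longrightarrow>
      (v has_real_derivative - (christoffel nabla (\<gamma> t) * (v t)\<^sup>2)) (at t within {0..1})"
    unfolding geodesic_def by blast
  show "convex_on {0..1} (f \<circ> \<gamma>)"
  proof (rule convex_on_Icc_if_DERIV2_nonneg)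
    fix t :: real
    assume t: "t \<in> {0..1}"
    show "((f \<circ> \<gamma>) has_real_derivative f' (\<gamma> t) * v t) (at t within {0..1})"
      using DERIV_chain[OF f(1) v(1)[OF t]] .
    show "((\<lambda>t. f' (\<gamma> t) * v t) has_real_derivative
        (f'' (\<gamma> t) - christoffel nabla (\<gamma> t) * f' (\<gamma> t)) * (v t)\<^sup>2) (at t within {0..1})"
      using DERIV_mult[OF DERIV_chain[OF f(2) v(1)[OF t]] v(2)[OF t]]
      by (simp add: comp_def algebra_simps power2_eq_square)
    show "0 \<le> (f'' (\<gamma> t) - christoffel nabla (\<gamma> t) * f' (\<gamma> t)) * (v t)\<^sup>2"
      using hess by simp
  qed
qed

text \<open>A nondecreasing sign vanishes on an interval, and a nonzero polynomial has finitely many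
  roots; so a nonzero \<open>f'\<close> has at most one root, which is split off with its full
  multiplicity.\<close>

lemma mono_sgn_poly_imp_g_convexifiable:
  fixes f :: "real poly"
  assumes mono: "mono (\<lambda>x. sgn (poly (pderiv f) x))"
  shows "\<exists>nabla. connection nabla \<and> g_convex nabla (poly f)"
proof -
  let ?p = "pderiv f"
  have "\<exists>q. (\<forall>x. poly q x \<noteq> 0) \<and>
      (\<forall>x. 0 \<le> poly (pderiv ?p) x - poly (pderiv q) x / poly q x * poly ?p x)"
  proof (cases "\<exists>x0. poly ?p x0 = 0 \<and> ?p \<noteq> 0")
    \<comment> \<open>If \<open>f'\<close> has no root, \<open>q = f'\<close> makes the Hessian
      vanish identically; if \<open>f' = 0\<close>, the constant 1 serves.\<close>
    case False
    show ?thesis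
    proof (cases "?p = 0")
      case True
      then show ?thesis by (intro exI[of _ 1]) simp
    next
      case nz: False
      then show ?thesis using False by (intro exI[of _ ?p]) simp
    qed
  next
    case True
    then obtain x0 where x0: "poly ?p x0 = 0" and nz: "?p \<noteq> 0" by blast
    let ?k = "order x0 ?p"
    obtain q where q: "?p = [:- x0, 1:] ^ ?k * q" "\<not> [:- x0, 1:] dvd q"
      using order_decomp[OF nz] by blast
    \<comment> \<open>The multiplicity is positive because \<open>x0\<close> is a root; its
      predecessor \<open>k\<close> is the exponent in the Hessian, so the \<open>k\<close> here is
      one less than the multiplicity.\<close>
    obtain k where k: "?k = Suc k"
      using x0 nz order_root not0_implies_Suc by blast
    have mono': "sgn (poly ?p x) \<le> sgn (poly ?p y)" if "x \<le> y" for x y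
      using monoD[OF mono that] .
    have zero_interval: "finite {x. poly ?p x = 0}"
      using nz poly_roots_finite by blast
    have uniq: "x = x0" if "poly ?p x = 0" for x
    proof (rule ccontr)
      assume "x \<noteq> x0"
      have "poly ?p z = 0" if "min x x0 \<le> z" "z \<le> max x x0" for z
      proof -
        have "sgn (poly ?p (min x x0)) = 0" "sgn (poly ?p (max x x0)) = 0"
          using x0 \<open>poly ?p x = 0\<close> by (simp_all add: min_def max_def)
        then have "sgn (poly ?p z) = 0"
          using mono'[OF that(1)] mono'[OF that(2)] by linarith
        then show ?thesis by (simp add: sgn_zero_iff)
      qed
      then have "{min x x0..max x x0} \<subseteq> {x. poly ?p x = 0}" by auto
      moreover have "infinite {min x x0..max x x0}"
        using \<open>x \<noteq> x0\<close> by (auto simp: infinite_Icc_iff)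
      ultimately show False using zero_interval finite_subset by blast
    qed
    have qnz: "poly q x \<noteq> 0" for x
    proof (cases "x = x0")
      case True
      then show ?thesis using q(2) by (simp add: poly_eq_0_iff_dvd)
    next
      case False
      then have "poly ?p x \<noteq> 0" using uniq by blast
      then show ?thesis by (subst (asm) q(1)) auto
    qed
    have p: "poly ?p x = (x - x0) ^ Suc k * poly q x" for x
      by (subst q(1), subst k) (simp only: poly_mult poly_power, simp)
    have p': "poly (pderiv ?p) x = of_nat (Suc k) * (x - x0) ^ k * poly q x
        + (x - x0) ^ Suc k * poly (pderiv q) x" for x
    proof -
      have "(poly ?p has_real_derivative of_nat (Suc k) * (x - x0) ^ k * poly q x
        + (x - x0) ^ Suc k * poly (pderiv q) x) (at x)"
        unfolding p[abs_def]
        by (rule derivative_eq_intros poly_DERIV refl)+ (simp add: mult_ac)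
      then show ?thesis using poly_DERIV DERIV_unique by blast
    qed
    have H: "poly (pderiv ?p) x - poly (pderiv q) x / poly q x * poly ?p x =
        of_nat (Suc k) * ((x - x0) ^ k * poly q x)" for x
    proof -
      have "poly (pderiv q) x / poly q x * (c * poly q x) = c * poly (pderiv q) x" for c
        using qnz[of x] by simp
      then show ?thesis
        unfolding p p' by (simp only: mult.assoc)
    qed
    have pos: "0 \<le> (x - x0) ^ k * poly q x" if "x \<noteq> x0" for x
    proof -
      have "0 \<le> sgn (poly ?p x) * (x - x0)"
        using mono'[of x x0] mono'[of x0 x] x0 that
        by (cases "x < x0") (auto simp: mult_nonpos_nonpos)
      then have "0 \<le> poly ?p x * (x - x0)"
        by (auto simp: sgn_if zero_le_mult_iff split: if_splits)
      also have "\<dots> = (x - x0)\<^sup>2 * ((x - x0) ^ k * poly q x)"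
        by (simp add: p power2_eq_square mult_ac)
      finally show ?thesis using that by (simp add: zero_le_mult_iff[of "_\<^sup>2"])
    qed
    \<comment> \<open>At \<open>x0\<close> the factor \<open>(x - x0)^2\<close> cannot be cancelled,
      so the inequality is passed to the limit. For \<open>k = 0\<close> the power is
      \<open>0 ^ 0 = 1\<close> and the claim concerns the sign of \<open>q\<close> at
      \<open>x0\<close>.\<close>
    have pos0: "0 \<le> (x0 - x0) ^ k * poly q x0"
    proof (rule tendsto_lowerbound)
      have "isCont (\<lambda>x. (x - x0) ^ k * poly q x) x0" by (intro continuous_intros)
      then show "((\<lambda>x. (x - x0) ^ k * poly q x) \<longlongrightarrow> (x0 - x0) ^ k * poly q x0) (at x0)"
        by (simp add: isCont_def)
      show "\<forall>\<^sub>F x in at x0. 0 \<le> (x - x0) ^ k * poly q x"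
        using pos by (simp add: eventually_at_filter)
    qed simp
    show ?thesis
      using qnz H pos pos0 by (intro exI[of _ q]) (metis mult_nonneg_nonneg of_nat_0_le_iff)
  qed
  then obtain q where q: "\<And>x. poly q x \<noteq> 0"
    "\<And>x. 0 \<le> poly (pderiv ?p) x - poly (pderiv q) x / poly q x * poly ?p x" by blast
  let ?nabla = "gamma_connection (\<lambda>x. poly (pderiv q) x / poly q x)"
  have "connection ?nabla"
    by (intro connection_gamma_connection smooth_fun_poly_quotient q(1))
  moreover have "g_convex ?nabla (poly f)"
    using q(2)
    by (intro convex_Hessian_imp_g_convex[OF poly_DERIV poly_DERIV])
       (simp add: christoffel_gamma_connection)
  ultimately show ?thesis by blast
qed

theorem g_convexifiable_poly_iff:
  "(\<exists>nabla. connection nabla \<and> g_convex nabla (poly f)) \<longleftrightarrow> mono (\<lambda>x. sgn (poly (pderiv f) x))"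
  using g_convex_imp_mono_sgn[OF _ _ poly_DERIV] mono_sgn_poly_imp_g_convexifiable by blast

section \<open>Measurability\<close>

lemma continuous_pos_rat_nbhd:
  fixes p :: "real \<Rightarrow> real"
  assumes "\<And>x. isCont p x" "0 < p x" "x < y"
  shows "\<exists>q::rat. x < real_of_rat q \<and> real_of_rat q < y \<and> 0 < p (real_of_rat q)"
proof -
  have "\<forall>\<^sub>F z in at x. 0 < p z"
    using assms(1)[of x] assms(2) by (auto simp: isCont_def dest: order_tendstoD)
  then obtain d where d: "0 < d" "\<And>z. z \<noteq> x \<Longrightarrow> dist z x < d \<Longrightarrow> 0 < p z"
    by (auto simp: eventually_at)
  obtain q where q: "x < real_of_rat q" "real_of_rat q < min y (x + d)"
    using of_rat_dense[of x "min y (x + d)"] d(1) assms(3) by auto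
  with d(2)[of "real_of_rat q"] show ?thesis
    by (auto simp: dist_real_def)
qed

text \<open>By compactness positivity is a uniform bound \<open>1 / Suc m\<close>, which can be
  tested at rationals. Conversely, continuity carries the bound to the interior and closedness
  carries it to the endpoints. This makes the condition a countable combination.\<close>

lemma continuous_pos_on_Icc_iff_rat:
  fixes p :: "real \<Rightarrow> real"
  assumes cont: "\<And>x. isCont p x" and "a < b"
  shows "(\<forall>x\<in>{a..b}. 0 < p x) \<longleftrightarrow>
    (\<exists>m::nat. \<forall>q::rat. real_of_rat q \<in> {a..b} \<longrightarrow> 1 / real (Suc m) \<le> p (real_of_rat q))"
proof
  assume pos: "\<forall>x\<in>{a..b}. 0 < p x"
  have "continuous_on {a..b} p"
    using cont by (simp add: continuous_at_imp_continuous_on)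
  then obtain c where c: "c \<in> {a..b}" "\<forall>x\<in>{a..b}. p c \<le> p x"
    using continuous_attains_inf[of "{a..b}" p] \<open>a < b\<close> by auto
  then obtain m where "1 / real (Suc m) < p c"
    using pos reals_Archimedean by (metis inverse_eq_divide)
  with c show "\<exists>m::nat. \<forall>q::rat. real_of_rat q \<in> {a..b} \<longrightarrow> 1 / real (Suc m) \<le> p (real_of_rat q)"
    by (intro exI[of _ m]) fastforce
next
  assume "\<exists>m::nat. \<forall>q::rat. real_of_rat q \<in> {a..b} \<longrightarrow> 1 / real (Suc m) \<le> p (real_of_rat q)"
  then obtain m :: nat
    where m: "\<And>q::rat. real_of_rat q \<in> {a..b} \<Longrightarrow> 1 / real (Suc m) \<le> p (real_of_rat q)" by blast
  have ge: "1 / real (Suc m) \<le> p x" if x: "x \<in> {a<..<b}" for x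
  proof (rule ccontr)
    assume "\<not> ?thesis"
    then obtain q :: rat where q: "x < real_of_rat q" "real_of_rat q < b"
        "0 < 1 / real (Suc m) - p (real_of_rat q)"
      using continuous_pos_rat_nbhd[of "\<lambda>x. 1 / real (Suc m) - p x" x b] cont x
      by (auto intro!: continuous_intros)
    with m[of q] x show False by simp
  qed
  have "1 / real (Suc m) \<le> p x" if "x \<in> {a..b}" for x
  proof -
    have "closed {x. 1 / real (Suc m) \<le> p x}"
      using cont by (intro closed_Collect_le continuous_intros continuous_at_imp_continuous_on) auto
    then have "closure {a<..<b} \<subseteq> {x. 1 / real (Suc m) \<le> p x}"
      using ge by (intro closure_minimal) auto
    then show ?thesis using that \<open>a < b\<close> by auto
  qed
  then show "\<forall>x\<in>{a..b}. 0 < p x"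
    by (metis divide_pos_pos less_le_trans of_nat_0_less_iff zero_less_Suc zero_less_one)
qed

text \<open>The half-line is exhausted by compact intervals; the length \<open>Suc n\<close> keeps
  each of them nondegenerate.\<close>

lemma continuous_pos_on_atLeast_iff_rat:
  fixes p :: "real \<Rightarrow> real"
  assumes cont: "\<And>x. isCont p x"
  shows "(\<forall>x\<ge>a. 0 < p x) \<longleftrightarrow> (\<forall>n::nat. \<exists>m::nat. \<forall>q::rat.
    real_of_rat q \<in> {a..a + real (Suc n)} \<longrightarrow> 1 / real (Suc m) \<le> p (real_of_rat q))"
proof -
  have "(\<forall>x\<ge>a. 0 < p x) \<longleftrightarrow> (\<forall>n::nat. \<forall>x\<in>{a..a + real (Suc n)}. 0 < p x)"
  proof (intro iffI allI impI)
    fix x assume *: "\<forall>n::nat. \<forall>x\<in>{a..a + real (Suc n)}. 0 < p x" "a \<le> x"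
    obtain n :: nat where "x - a \<le> real n"
      using real_arch_simple by blast
    then have "x \<le> a + real (Suc n)" by simp
    with * show "0 < p x" by (metis atLeastAtMost_iff)
  qed auto
  also have "\<dots> \<longleftrightarrow> (\<forall>n::nat. \<exists>m::nat. \<forall>q::rat.
    real_of_rat q \<in> {a..a + real (Suc n)} \<longrightarrow> 1 / real (Suc m) \<le> p (real_of_rat q))"
    by (intro all_cong1 continuous_pos_on_Icc_iff_rat cont) simp
  finally show ?thesis .
qed

lemma isCont_uminus_reflect:
  fixes p :: "real \<Rightarrow> real"
  assumes "\<And>x. isCont p x"
  shows "isCont (\<lambda>x. - p (- x)) x"
  by (rule isCont_minus[OF isCont_o2[where g=p and f=uminus, OF _ assms]]) simp

text \<open>A sign is nondecreasing iff positivity persists to the right and negativity to the left.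
  By continuity rational starting points suffice. Negativity is reflected to
  \<open>- p (- x)\<close>, so that both halves ask for positivity on a half-line.\<close>

lemma mono_sgn_iff_rat:
  fixes p :: "real \<Rightarrow> real"
  assumes cont: "\<And>x. isCont p x"
  shows "mono (\<lambda>x. sgn (p x)) \<longleftrightarrow>
    (\<forall>q::rat. (0 < p (of_rat q) \<longrightarrow> (\<forall>x\<ge>of_rat q. 0 < p x)) \<and>
              (0 < - p (of_rat q) \<longrightarrow> (\<forall>x\<ge>- of_rat q. 0 < - p (- x))))"
  (is "_ \<longleftrightarrow> ?R")
proof
  assume mono: "mono (\<lambda>x. sgn (p x))"
  show ?R
  proof (intro allI conjI impI)
    show "0 < p x" if "0 < p (of_rat q)" "of_rat q \<le> x" for q x
      using monoD[OF mono that(2)] that(1) by (auto simp: sgn_if split: if_splits)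
    show "0 < - p (- x)" if "0 < - p (of_rat q)" "- of_rat q \<le> x" for q x
      using monoD[OF mono, of "- x" "of_rat q"] that by (auto simp: sgn_if split: if_splits)
  qed
next
  assume R: ?R
  show "mono (\<lambda>x. sgn (p x))"
  proof (rule monoI)
    fix x y :: real
    assume "x \<le> y"
    show "sgn (p x) \<le> sgn (p y)"
    proof (cases "x = y")
      case False
      then have "x < y" using \<open>x \<le> y\<close> by simp
      have 1: "0 < p y" if p_pos: "0 < p x"
      proof -
        obtain q where "x < real_of_rat q" "real_of_rat q < y" "0 < p (real_of_rat q)"
          using continuous_pos_rat_nbhd[OF cont p_pos \<open>x < y\<close>] by blast
        then show ?thesis using R by (meson less_imp_le)
      qed
      have 2: "p x < 0" if p_neg: "p y < 0"
      proof -
        obtain q where q: "- y < real_of_rat q" "real_of_rat q < - x" "0 < - p (- real_of_rat q)"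
          using continuous_pos_rat_nbhd[of "\<lambda>z. - p (- z)" "- y" "- x"] p_neg \<open>x < y\<close>
            isCont_uminus_reflect[OF cont] by auto
        then have "\<forall>z\<ge>real_of_rat q. 0 < - p (- z)"
          using R[THEN spec, of "- q"] by (simp add: of_rat_minus)
        then have "0 < - p (- (- x))"
          using q(2) by (meson less_imp_le)
        then show ?thesis by simp
      qed
      show ?thesis
      proof (cases "p x" "0::real" rule: linorder_cases)
        case equal
        with 2 have "\<not> p y < 0" by auto
        with equal show ?thesis by (simp add: sgn_if)
      qed (use 1 in \<open>simp_all add: sgn_if\<close>)
    qed simp
  qed
qed

lemma measurable_mono_sgn:
  fixes p :: "'a \<Rightarrow> real \<Rightarrow> real"
  assumes cont: "\<And>a x. isCont (p a) x" and [measurable]: "\<And>x. (\<lambda>a. p a x) \<in> borel_measurable M"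
  shows "Measurable.pred M (\<lambda>a. mono (\<lambda>x. sgn (p a x)))"
proof -
  have c2: "isCont (\<lambda>x. - p a (- x)) x" for a x
    by (rule isCont_uminus_reflect[OF cont])
  show ?thesis
    unfolding mono_sgn_iff_rat[OF cont] continuous_pos_on_atLeast_iff_rat[OF cont]
      continuous_pos_on_atLeast_iff_rat[OF c2]
    by measurable
qed

section \<open>The g-convexifiable coefficient vectors as a measurable event\<close>

lemma poly_pderiv_coeff_poly:
  "poly (pderiv (coeff_poly d a)) x = (\<Sum>j\<le>d. of_nat j * x ^ (j - 1) * a j)"
  unfolding coeff_poly_def
  by (induction d) (simp_all add: pderiv_add pderiv_monom poly_monom mult_ac)

lemma g_convexifiable_eq:
  "g_convexifiable d r = {a \<in> coeff_box d r. mono (\<lambda>x. sgn (poly (pderiv (coeff_poly d a)) x))}"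
  by (simp add: g_convexifiable_def g_convexifiable_poly_iff)

lemma sets_coeff_distr [measurable_cong]:
  "sets (coeff_distr d r) = sets (Pi\<^sub>M {..d} (\<lambda>_. borel))"
  by (simp add: coeff_distr_def cong: sets_PiM_cong)

lemma coeff_box_sets [measurable]: "coeff_box d r \<in> sets (Pi\<^sub>M {..d} (\<lambda>_. borel))"
  by (auto simp: coeff_box_def intro!: sets_PiM_I_finite)

lemma g_convexifiable_sets: "g_convexifiable d r \<in> sets (coeff_distr d r)"
proof -
  have [measurable]: "Measurable.pred (Pi\<^sub>M {..d} (\<lambda>_. borel))
      (\<lambda>a. mono (\<lambda>x. sgn (poly (pderiv (coeff_poly d a)) x)))"
    by (rule measurable_mono_sgn) (auto simp: poly_pderiv_coeff_poly)
  have "{a \<in> space (Pi\<^sub>M {..d} (\<lambda>_. borel)). a \<in> coeff_box d r \<and>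
      mono (\<lambda>x. sgn (poly (pderiv (coeff_poly d a)) x))} \<in> sets (Pi\<^sub>M {..d} (\<lambda>_. borel))"
    by measurable
  also have "{a \<in> space (Pi\<^sub>M {..d} (\<lambda>_. borel)). a \<in> coeff_box d r \<and>
      mono (\<lambda>x. sgn (poly (pderiv (coeff_poly d a)) x))} = g_convexifiable d r"
    by (auto simp: g_convexifiable_eq coeff_box_def space_PiM)
  finally show ?thesis by (simp add: sets_coeff_distr)
qed

section \<open>The uniform distribution on the coefficient box\<close>

lemma emeasure_lborel_Icc_symmetric:
  assumes "0 < r"
  shows "emeasure lborel {-r..r} = ennreal (2 * r)"
proof -
  have "- r \<le> r" "r - - r = 2 * r"
    using assms by linarith+
  then show ?thesis
    using emeasure_lborel_Icc[of "- r" r] by (simp only:)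
qed

lemma prob_space_uniform_Icc:
  fixes r :: real
  assumes "0 < r"
  shows "prob_space (uniform_measure lborel {-r..r})"
proof (rule prob_space_uniform_measure)
  show "emeasure lborel {-r..r} \<noteq> 0"
    unfolding emeasure_lborel_Icc_symmetric[OF assms] ennreal_eq_0_iff using assms by linarith
  show "emeasure lborel {-r..r} \<noteq> \<infinity>"
    unfolding emeasure_lborel_Icc_symmetric[OF assms] infinity_ennreal_def by (rule ennreal_neq_top)
qed

lemma emeasure_PiM_lborel_box:
  assumes "\<And>i. i \<le> d \<Longrightarrow> A i \<in> sets borel"
  shows "emeasure (Pi\<^sub>M {..d::nat} (\<lambda>_. lborel)) (Pi\<^sub>E {..d} A) = (\<Prod>i\<le>d. emeasure lborel (A i :: real set))"
proof (rule product_sigma_finite.emeasure_PiM)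
  show "product_sigma_finite (\<lambda>_::nat. lborel :: real measure)"
    by (simp add: product_sigma_finite_def sigma_finite_lborel)
qed (simp_all add: assms)

lemma sets_PiM_lborel_box:
  assumes "\<And>i. i \<le> d \<Longrightarrow> A i \<in> sets borel"
  shows "Pi\<^sub>E {..d::nat} A \<in> sets (Pi\<^sub>M {..d} (\<lambda>_. lborel :: real measure))"
  by (rule sets_PiM_I_finite) (simp_all add: assms)

lemma emeasure_coeff_distr_box:
  assumes "0 < r" and A: "\<And>i. i \<le> d \<Longrightarrow> A i \<in> sets borel"
  shows "emeasure (coeff_distr d r) (Pi\<^sub>E {..d} A) =
    (\<Prod>i\<le>d. emeasure (uniform_measure lborel {-r..r}) (A i))"
proof -
  have Int: "coeff_box d r \<inter> Pi\<^sub>E {..d} A = Pi\<^sub>E {..d} (\<lambda>i. {-r..r} \<inter> A i)"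
    by (simp add: coeff_box_def PiE_Int)
  have "emeasure (coeff_distr d r) (Pi\<^sub>E {..d} A) =
      emeasure (Pi\<^sub>M {..d} (\<lambda>_. lborel)) (coeff_box d r \<inter> Pi\<^sub>E {..d} A) /
      emeasure (Pi\<^sub>M {..d} (\<lambda>_. lborel)) (coeff_box d r)"
    unfolding coeff_distr_def coeff_box_def
    by (rule emeasure_uniform_measure) (rule sets_PiM_lborel_box, simp add: A)+
  also have "emeasure (Pi\<^sub>M {..d} (\<lambda>_. lborel)) (coeff_box d r) = (\<Prod>i\<le>d. ennreal (2 * r))"
    unfolding coeff_box_def using assms(1)
    by (subst emeasure_PiM_lborel_box) (simp_all only: emeasure_lborel_Icc_symmetric borel_closed closed_real_atLeastAtMost)
  also have "emeasure (Pi\<^sub>M {..d} (\<lambda>_. lborel)) (coeff_box d r \<inter> Pi\<^sub>E {..d} A) =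
      (\<Prod>i\<le>d. emeasure lborel ({-r..r} \<inter> A i))"
    unfolding Int by (rule emeasure_PiM_lborel_box) (intro sets.Int borel_closed closed_real_atLeastAtMost A)
  also have "\<dots> / (\<Prod>i\<le>d. ennreal (2 * r)) = (\<Prod>i\<le>d. emeasure lborel ({-r..r} \<inter> A i) / ennreal (2 * r))"
    using assms(1) ennreal_inverse_power[of "ennreal (2 * r)" "Suc d"]
    by (simp only: divide_ennreal_def prod.distrib prod_constant card_atMost)
  also have "\<dots> = (\<Prod>i\<le>d. emeasure (uniform_measure lborel {-r..r}) (A i))"
    by (intro prod.cong refl)
       (simp only: emeasure_uniform_measure emeasure_lborel_Icc_symmetric[OF assms(1)] A
         sets_lborel borel_closed closed_real_atLeastAtMost atMost_iff)
  finally show ?thesis .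
qed

text \<open>Both measures agree on product sets, which determine the product measure. This is where
  the coefficients become independent.\<close>

lemma coeff_distr_eq_PiM:
  assumes "0 < r"
  shows "coeff_distr d r = Pi\<^sub>M {..d} (\<lambda>_. uniform_measure lborel {-r..r})"
proof (rule product_sigma_finite.PiM_eqI)
  show "product_sigma_finite (\<lambda>_::nat. uniform_measure lborel {-r..r})"
    using prob_space_uniform_Icc[OF assms]
    by (simp add: product_sigma_finite_def prob_space_imp_sigma_finite)
  show "sets (coeff_distr d r) = sets (Pi\<^sub>M {..d} (\<lambda>_. uniform_measure lborel {-r..r}))"
    unfolding sets_coeff_distr by (rule sets_PiM_cong) simp_all
  show "emeasure (coeff_distr d r) (Pi\<^sub>E {..d} A) =
      (\<Prod>i\<le>d. emeasure (uniform_measure lborel {-r..r}) (A i))"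
    if "\<And>i. i \<in> {..d} \<Longrightarrow> A i \<in> sets (uniform_measure lborel {-r..r})" for A
    using that by (intro emeasure_coeff_distr_box assms) simp
qed simp

lemma second_moment_uniform:
  fixes r :: real
  assumes "0 < r"
  shows "(\<integral>u. u\<^sup>2 \<partial>uniform_measure lborel {-r..r}) = r\<^sup>2 / 3"
proof -
  have density: "uniform_measure lborel {-r..r} =
      density lborel (\<lambda>u. ennreal (indicator {-r..r} u / (2 * r)))"
    unfolding uniform_measure_def
  proof (rule density_cong)
    show "AE u in lborel. indicator {-r..r} u / emeasure lborel {-r..r} =
        ennreal (indicator {-r..r} u / (2 * r))"
      using assms by (intro AE_I2) (simp add: indicator_def divide_ennreal flip: ennreal_1)
  qed auto
  have "(\<integral>u. u\<^sup>2 \<partial>uniform_measure lborel {-r..r}) =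
      (\<integral>u. (1 / (2 * r)) * (u\<^sup>2 * indicator {-r..r} u) \<partial>lborel)"
    unfolding density using assms
    by (subst integral_density) (auto simp: mult_ac)
  also have "\<dots> = (1 / (2 * r)) * ((r ^ 3 - (- r) ^ 3) / 3)"
    using integral_power[of "-r" r 2] assms by (simp add: eval_nat_numeral)
  also have "\<dots> = r\<^sup>2 / 3"
    using assms by (simp add: field_simps eval_nat_numeral)
  finally show ?thesis .
qed

section \<open>The derivative at the points \<open>1 - 4\<^sup>-\<^sup>k\<close>\<close>

text \<open>The weights \<open>j * (j + 1)\<close> arise by differentiating the geometric series
  twice, so their partial sums have a closed form with an explicit remainder; they dominate
  \<open>j^2\<close> in the next estimate.\<close>

lemma sum_squares_geometric_identity:
  fixes z :: real
  shows "(1 - z) ^ 3 * (\<Sum>j\<le>n. of_nat j * of_nat (Suc j) * z ^ (j - 1)) =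
    2 - z ^ n * (2 + 2 * of_nat n * (1 - z) + of_nat n * of_nat (Suc n) * (1 - z)\<^sup>2)"
proof (induction n)
  case (Suc n)
  then show ?case
    by (simp add: distrib_left) (simp add: algebra_simps eval_nat_numeral)
qed simp

lemma sum_squares_geometric_le:
  fixes z :: real
  assumes "0 \<le> z" "z < 1"
  shows "(\<Sum>j\<le>n. (of_nat j)\<^sup>2 * z ^ (j - 1)) \<le> 2 / (1 - z) ^ 3"
proof -
  have "(\<Sum>j\<le>n. (of_nat j)\<^sup>2 * z ^ (j - 1)) \<le> (\<Sum>j\<le>n. of_nat j * of_nat (Suc j) * z ^ (j - 1))"
    using assms by (intro sum_mono mult_right_mono) (auto simp: power2_eq_square intro!: mult_left_mono)
  also have "(1 - z) ^ 3 * \<dots> \<le> 2"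
    unfolding sum_squares_geometric_identity using assms by simp
  then have "(\<Sum>j\<le>n. of_nat j * of_nat (Suc j) * z ^ (j - 1)) \<le> 2 / (1 - z) ^ 3"
    using assms by (simp add: field_simps)
  finally show ?thesis .
qed

lemma sum_squares_ge: "(real n) ^ 3 / 3 \<le> (\<Sum>j\<le>n. (real j)\<^sup>2)"
proof (induction n)
  case (Suc n)
  then show ?case
    by (simp add: algebra_simps eval_nat_numeral)
qed simp

text \<open>At distance \<open>1 / (4 * N)\<close> from 1, Bernoulli's inequality keeps the
  geometric factor above 1/2 for all \<open>j \<le> N\<close>, so the sum is at least half of that
  of the first squares.\<close>

lemma sum_squares_geometric_ge:
  fixes N d :: nat
  assumes "1 \<le> N" "N \<le> d"
  shows "(real N) ^ 3 / 6 \<le> (\<Sum>j\<le>d. (real j)\<^sup>2 * ((1 - 1 / (4 * real N))\<^sup>2) ^ (j - 1))"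
proof -
  let ?x = "1 - 1 / (4 * real N)"
  have x: "0 \<le> ?x" using assms(1) by (simp add: field_simps)
  have half: "1 / 2 \<le> (?x\<^sup>2) ^ (j - 1)" if "j \<le> N" for j
  proof -
    have "real (2 * (j - 1)) \<le> 2 * real N" using that by linarith
    then have "1 / 2 \<le> 1 + real (2 * (j - 1)) * (- (1 / (4 * real N)))"
      using assms(1) by (simp add: field_simps)
    also have "\<dots> \<le> (1 + - (1 / (4 * real N))) ^ (2 * (j - 1))"
      using assms(1) by (intro Bernoulli_inequality) (simp add: field_simps)
    finally show ?thesis by (simp add: power_mult)
  qed
  have "(real N) ^ 3 / 6 \<le> (\<Sum>j\<le>N. (real j)\<^sup>2 * (1 / 2))"
    using sum_squares_ge[of N] by (simp add: sum_divide_distrib[symmetric])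
  also have "\<dots> \<le> (\<Sum>j\<le>N. (real j)\<^sup>2 * (?x\<^sup>2) ^ (j - 1))"
    using half by (intro sum_mono mult_left_mono) auto
  also have "\<dots> \<le> (\<Sum>j\<le>d. (real j)\<^sup>2 * (?x\<^sup>2) ^ (j - 1))"
    using assms(2) x by (intro sum_mono2) auto
  finally show ?thesis .
qed

text \<open>The exponent is the distance of \<open>k\<close> and \<open>l\<close>, with
  \<open>max\<close> and \<open>min\<close> avoiding truncated subtraction. The indices up to
  \<open>k\<close> and those above it are each bounded by a full geometric series.\<close>

lemma sum_geometric_dist_le:
  fixes T :: "nat set" and q :: real
  assumes "finite T" "0 \<le> q" "q < 1"
  shows "(\<Sum>l\<in>T. q ^ (max k l - min k l)) \<le> 2 / (1 - q)"
proof -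
  have geo: "(\<Sum>l\<in>I. q ^ g l) \<le> 1 / (1 - q)" if "finite I" "inj_on g I" for I and g :: "nat \<Rightarrow> nat"
  proof -
    have "(\<Sum>l\<in>I. q ^ g l) = (\<Sum>i\<in>g ` I. q ^ i)"
      using that(2) by (simp add: sum.reindex)
    also have "\<dots> \<le> (\<Sum>i. q ^ i)"
      using assms that by (intro sum_le_suminf summable_geometric) auto
    finally show ?thesis
      using assms by (simp add: suminf_geometric)
  qed
  have "(\<Sum>l\<in>T. q ^ (max k l - min k l)) =
      (\<Sum>l\<in>{l \<in> T. l \<le> k}. q ^ (max k l - min k l)) + (\<Sum>l\<in>{l \<in> T. \<not> l \<le> k}. q ^ (max k l - min k l))"
    using assms(1) by (subst sum.union_disjoint[symmetric]) (auto intro!: sum.cong)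
  also have "\<dots> \<le> 1 / (1 - q) + 1 / (1 - q)"
    using assms(1) by (intro add_mono geo) (auto simp: inj_on_def max_def min_def split: if_splits)
  finally show ?thesis by simp
qed

section \<open>Sample points near 1 and the normalised values of the derivative\<close>

definition node :: "nat \<Rightarrow> real" where
  "node k = 1 - 1 / 4 ^ k"

lemma node_bounds: "0 \<le> node k" "node k < 1"
  by (simp_all add: node_def field_simps)

lemma strict_mono_node: "strict_mono node"
  unfolding strict_mono_Suc_iff by (simp add: node_def field_simps)

text \<open>Coefficients of \<open>f'\<close> at \<open>node k\<close> over
  \<open>2 * r * 8 ^ k\<close>: for large degree the standard deviation there is of order
  \<open>r * 8 ^ k\<close>. The factor 2 brings the bound on the squared norm low enough for
  \<open>weight_small\<close>.\<close>

definition weight :: "real \<Rightarrow> nat \<Rightarrow> nat \<Rightarrow> real" where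
  "weight r k j = real j * node k ^ (j - 1) / (2 * r * 8 ^ k)"

lemma weight_nonneg: "0 < r \<Longrightarrow> 0 \<le> weight r k j"
  by (simp add: weight_def node_bounds)

lemma weight_inner:
  assumes "0 < r"
  shows "r\<^sup>2 * (\<Sum>j\<le>d. weight r k j * weight r l j) =
    (\<Sum>j\<le>d. (real j)\<^sup>2 * (node k * node l) ^ (j - 1)) / (4 * 8 ^ (k + l))"
  using assms
  by (simp add: weight_def sum_distrib_left sum_divide_distrib power_mult_distrib power_add
      power2_eq_square field_simps)

lemma eight_power_double: "(8::real) ^ (i + i) = (4 ^ i) ^ 3"
proof -
  have "((4::real) ^ i) ^ 3 = (4 ^ 3) ^ i"
    by (simp only: power_mult[symmetric] mult.commute)
  moreover have "(8::real) ^ (i + i) = (8 * 8) ^ i"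
    by (simp only: power_add power_mult_distrib)
  ultimately show ?thesis by simp
qed

text \<open>With \<open>m = min k l\<close>, the distance of the product of the nodes from 1 is at
  least \<open>4 ^ (-m)\<close>, so the sum is at most \<open>2 * 64 ^ m\<close>. The normalisation
  \<open>4 * 8 ^ (k + l)\<close> exceeds \<open>64 ^ m\<close> by a power of 8 in the distance of
  the indices, which is the decay.\<close>

lemma weight_inner_le:
  assumes "0 < r"
  shows "r\<^sup>2 * (\<Sum>j\<le>d. weight r k j * weight r l j) \<le> (1 / 8) ^ (max k l - min k l) / 2"
proof -
  let ?m = "min k l" and ?M = "max k l"
  have "node k * node l \<le> node ?m"
    using node_bounds[of k] node_bounds[of l]
    by (cases "k \<le> l") (simp_all add: min_def mult_left_le_one_le mult_right_le_one_le)
  then have ge: "1 / 4 ^ ?m \<le> 1 - node k * node l"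
    by (simp add: node_def[of ?m])
  have pos: "0 < 1 - node k * node l"
    using ge by (rule less_le_trans[rotated]) simp
  have "(\<Sum>j\<le>d. (real j)\<^sup>2 * (node k * node l) ^ (j - 1)) \<le> 2 / (1 - node k * node l) ^ 3"
    using node_bounds[of k] node_bounds[of l] pos
    by (intro sum_squares_geometric_le) auto
  also have "\<dots> \<le> 2 / (1 / 4 ^ ?m) ^ 3"
    using ge pos by (intro divide_left_mono power_mono mult_pos_pos zero_less_power) auto
  also have "\<dots> = 2 * 8 ^ (?m + ?m)"
    by (simp add: power_divide eight_power_double)
  finally have "r\<^sup>2 * (\<Sum>j\<le>d. weight r k j * weight r l j) \<le> 2 * 8 ^ (?m + ?m) / (4 * 8 ^ (k + l))"
    unfolding weight_inner[OF assms] by (intro divide_right_mono) auto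
  also have "(8::real) ^ (k + l) = 8 ^ (?m + ?m) * 8 ^ (?M - ?m)"
    by (simp add: power_add[symmetric] min_def max_def)
  finally show ?thesis
    by (simp add: power_divide)
qed

text \<open>One term is at most the whole squared norm. This keeps the arguments of the cosines of
  single coefficients in [-1,1].\<close>

lemma weight_small:
  assumes "0 < r" "j \<le> d"
  shows "r * weight r k j \<le> 1"
proof -
  have "(r * weight r k j)\<^sup>2 \<le> r\<^sup>2 * (\<Sum>j\<le>d. weight r k j * weight r k j)"
    using assms member_le_sum[of j "{..d}" "\<lambda>j. weight r k j * weight r k j"]
    by (simp add: power_mult_distrib power2_eq_square mult_left_mono)
  also have "\<dots> \<le> 1 / 2"
    using weight_inner_le[OF assms(1), where d=d and k=k and l=k] by simp
  finally have "(r * weight r k j)\<^sup>2 \<le> 1\<^sup>2" by simp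
  then show ?thesis by (rule power2_le_imp_le) simp
qed

text \<open>With \<open>N = 4 ^ (k - 1)\<close> the node is at distance \<open>1 / (4 * N)\<close>
  from 1. The constant is \<open>1/6\<close> from the sum, \<open>1/4\<close> and
  \<open>1/64\<close> from the normalisation, and \<open>1/3\<close> from the variance
  \<open>r^2 / 3\<close> of a coefficient.\<close>

lemma weight_norm_ge:
  assumes "0 < r" "1 \<le> k" "4 ^ (k - 1) \<le> d"
  shows "1 / 4608 \<le> r\<^sup>2 / 3 * (\<Sum>j\<le>d. (weight r k j)\<^sup>2)"
proof -
  obtain i where k: "k = Suc i" using assms(2) by (cases k) auto
  have "node k = 1 - 1 / (4 * real (4 ^ i))"
    by (simp add: node_def k)
  then have "(real (4 ^ i)) ^ 3 / 6 \<le> (\<Sum>j\<le>d. (real j)\<^sup>2 * (node k * node k) ^ (j - 1))"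
    using sum_squares_geometric_ge[of "4 ^ i" d] assms(3) by (simp add: k power2_eq_square)
  then have "((4::real) ^ i) ^ 3 / 6 / (4 * 8 ^ (k + k)) \<le> r\<^sup>2 * (\<Sum>j\<le>d. weight r k j * weight r k j)"
    unfolding weight_inner[OF assms(1)] by (intro divide_right_mono) simp_all
  then show ?thesis
    by (simp add: k power2_eq_square eight_power_double[symmetric])
qed

section \<open>Linear forms in bounded symmetric coefficients\<close>

lemma one_minus_cos_le_abs: "1 - cos x \<le> \<bar>x\<bar>" for x :: real
proof -
  have "1 - cos x = 2 * (sin (x / 2))\<^sup>2"
    using cos_double_sin[of "x / 2"] by simp
  also have "\<dots> = 2 * (\<bar>sin (x / 2)\<bar> * \<bar>sin (x / 2)\<bar>)"
    by (simp add: power2_eq_square)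
  also have "\<dots> \<le> 2 * (\<bar>x / 2\<bar> * 1)"
    by (intro mult_left_mono mult_mono abs_sin_x_le_abs_x abs_sin_le_one) simp_all
  finally show ?thesis by simp
qed

text \<open>Since \<open>x^4 \<le> x^2\<close> here, the quartic Taylor remainder is absorbed into
  the quadratic term: \<open>11/24 = 1/2 - 1/24\<close>.\<close>

lemma cos_le_one_minus_square:
  fixes x :: real
  assumes "\<bar>x\<bar> \<le> 1"
  shows "cos x \<le> 1 - 11 / 24 * x\<^sup>2"
proof -
  obtain t where "cos x = (\<Sum>m<4. cos_coeff m * x ^ m) + cos (t + 1 / 2 * real 4 * pi) / fact 4 * x ^ 4"
    using Maclaurin_cos_expansion[of x 4] by blast
  moreover have "(\<Sum>m<4. cos_coeff m * x ^ m) = 1 - x\<^sup>2 / 2"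
  proof -
    have "(\<Sum>m<4. f m) = f 0 + f 1 + f 2 + f 3" for f :: "nat \<Rightarrow> real"
      by (simp add: eval_nat_numeral)
    then show ?thesis by (simp add: cos_coeff_def fact_numeral)
  qed
  moreover have "cos (t + 1 / 2 * real 4 * pi) / fact 4 * x ^ 4 \<le> 1 / 24 * x ^ 4"
    by (intro mult_right_mono) (auto simp: fact_numeral)
  moreover have "x ^ 4 \<le> x ^ 2"
    using power_decreasing[of 2 4 "\<bar>x\<bar>"] assms by (simp add: power_even_abs)
  ultimately show ?thesis by simp
qed

lemma measurable_cis [measurable]: "cis \<in> borel_measurable borel"
  by (intro borel_measurable_continuous_onI continuous_intros)

text \<open>Symmetry removes odd moments and makes the characteristic function \<open>chf\<close> of
  a coefficient real; boundedness controls \<open>chf\<close> near 0 and the second moment.\<close>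

locale bounded_symmetric_coefficients =
  fixes \<mu> :: "real measure" and r :: real and d :: nat
  assumes prob_space_\<mu>: "prob_space \<mu>"
    and sets_\<mu> [measurable_cong]: "sets \<mu> = sets borel"
    and r_pos: "0 < r"
    and bounded: "AE u in \<mu>. \<bar>u\<bar> \<le> r"
    and symmetric: "distr \<mu> borel uminus = \<mu>"
begin

abbreviation joint :: "(nat \<Rightarrow> real) measure" where
  "joint \<equiv> Pi\<^sub>M {..d} (\<lambda>_. \<mu>)"

definition chf :: "real \<Rightarrow> real" where
  "chf t = (\<integral>u. cos (t * u) \<partial>\<mu>)"

definition lin :: "(nat \<Rightarrow> real) \<Rightarrow> (nat \<Rightarrow> real) \<Rightarrow> real" where
  "lin c a = (\<Sum>j\<le>d. c j * a j)"

lemma prob_space_joint: "prob_space joint"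
  by (intro prob_space_PiM prob_space_\<mu>)

lemma product_sigma_finite_\<mu>: "product_sigma_finite (\<lambda>_::nat. \<mu>)"
  using prob_space_\<mu> by (simp add: product_sigma_finite_def prob_space_imp_sigma_finite)

lemma measure_space_\<mu> [simp]: "measure \<mu> (space \<mu>) = 1"
  using prob_space_\<mu> by (rule prob_space.prob_space)

lemma integrable_const_\<mu> [simp]: "integrable \<mu> (\<lambda>_. c :: real)"
  using finite_measure.integrable_const[OF prob_space.finite_measure[OF prob_space_\<mu>]] .

lemmas integrable_\<mu>_if_bounded =
  finite_measure.integrable_const_bound[OF prob_space.finite_measure[OF prob_space_\<mu>]]

lemmas integrable_joint_if_bounded =
  finite_measure.integrable_const_bound[OF prob_space.finite_measure[OF prob_space_joint]]

lemma lin_measurable [measurable]: "lin c \<in> borel_measurable joint"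
  unfolding lin_def by measurable

lemma lin_add: "lin (\<lambda>j. c j + c' j) a = lin c a + lin c' a"
  by (simp add: lin_def sum.distrib algebra_simps)

lemma lin_sum: "lin (\<lambda>j. \<Sum>k\<in>T. b k j) a = (\<Sum>k\<in>T. lin (b k) a)"
  unfolding lin_def by (simp add: sum_distrib_right sum.swap[of _ "{..d}" T])

lemma lin_uminus: "lin (\<lambda>j. - c j) a = - lin c a"
  by (simp add: lin_def sum_negf)

lemma integral_reflect:
  fixes f :: "real \<Rightarrow> real"
  assumes [measurable]: "f \<in> borel_measurable borel"
  shows "(\<integral>u. f (- u) \<partial>\<mu>) = (\<integral>u. f u \<partial>\<mu>)"
  by (subst (2) symmetric[symmetric]) (simp add: integral_distr)

lemma integral_odd:
  fixes f :: "real \<Rightarrow> real"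
  assumes "f \<in> borel_measurable borel" "\<And>u. f (- u) = - f u"
  shows "(\<integral>u. f u \<partial>\<mu>) = 0"
  using integral_reflect[OF assms(1)] assms(2) by simp

lemma integrable_bounded_AE:
  fixes f :: "real \<Rightarrow> real"
  assumes [measurable]: "f \<in> borel_measurable borel" and "\<And>u. \<bar>u\<bar> \<le> r \<Longrightarrow> \<bar>f u\<bar> \<le> B"
  shows "integrable \<mu> f"
proof (rule integrable_\<mu>_if_bounded)
  show "AE u in \<mu>. norm (f u) \<le> B"
    using bounded by eventually_elim (simp add: assms)
qed simp

lemma integrable_square: "integrable \<mu> (\<lambda>u. u\<^sup>2)"
  by (rule integrable_bounded_AE[where B="r\<^sup>2"]) (auto simp: abs_le_square_iff[symmetric])

lemma abs_integral_le_const: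
  fixes f :: "real \<Rightarrow> real"
  assumes [measurable]: "f \<in> borel_measurable borel" and "\<And>u. \<bar>u\<bar> \<le> r \<Longrightarrow> \<bar>f u\<bar> \<le> B"
  shows "\<bar>\<integral>u. f u \<partial>\<mu>\<bar> \<le> B"
proof -
  have "\<bar>\<integral>u. f u \<partial>\<mu>\<bar> \<le> (\<integral>u. \<bar>f u\<bar> \<partial>\<mu>)"
    by (rule integral_abs_bound)
  also have "\<dots> \<le> (\<integral>u. B \<partial>\<mu>)"
    using bounded integrable_bounded_AE[OF assms]
    by (intro integral_mono_AE) (auto simp: assms elim: eventually_mono)
  finally show ?thesis by simp
qed

section \<open>Characteristic functions and covariances of cosines\<close>

lemma chf_abs_le: "\<bar>chf t\<bar> \<le> 1"
  unfolding chf_def by (rule abs_integral_le_const) auto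

text \<open>\<open>cis\<close> turns the sum into a product over independent coefficients; by
  symmetry each factor has expectation \<open>chf\<close>, as the sine part is odd. The cosine is
  the real part.\<close>

lemma expectation_cos_lin: "(\<integral>a. cos (lin c a) \<partial>joint) = (\<Prod>j\<le>d. chf (c j))"
proof -
  have int: "integrable \<mu> (\<lambda>u. cis (t * u))" for t
    by (rule integrable_\<mu>_if_bounded[where B=1]) auto
  have "(\<integral>u. cis (t * u) \<partial>\<mu>) = complex_of_real (chf t)" for t
  proof (rule complex_eqI)
    show "Re (\<integral>u. cis (t * u) \<partial>\<mu>) = Re (complex_of_real (chf t))"
      using int by (simp add: chf_def flip: integral_Re)
    have "Im (\<integral>u. cis (t * u) \<partial>\<mu>) = (\<integral>u. sin (t * u) \<partial>\<mu>)"
      using int by (simp flip: integral_Im)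
    then show "Im (\<integral>u. cis (t * u) \<partial>\<mu>) = Im (complex_of_real (chf t))"
      by (simp add: integral_odd)
  qed
  then have "(\<integral>a. (\<Prod>j\<le>d. cis (c j * a j)) \<partial>joint) = (\<Prod>j\<le>d. complex_of_real (chf (c j)))"
    by (subst product_sigma_finite.product_integral_prod[OF product_sigma_finite_\<mu>]) (auto simp: int)
  also have "(\<lambda>a. \<Prod>j\<le>d. cis (c j * a j)) = (\<lambda>a. cis (lin c a))"
    by (simp add: lin_def cis_conv_exp exp_sum sum_distrib_left)
  finally have "(\<integral>a. cis (lin c a) \<partial>joint) = complex_of_real (\<Prod>j\<le>d. chf (c j))"
    by simp
  moreover have "integrable joint (\<lambda>a. cis (lin c a))"
    by (rule integrable_joint_if_bounded[where B=1]) auto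
  then have "(\<integral>a. Re (cis (lin c a)) \<partial>joint) = Re (\<integral>a. cis (lin c a) \<partial>joint)"
    by (rule integral_Re)
  ultimately show ?thesis by (simp del: of_real_prod)
qed

\<comment> \<open>The addition theorem writes the difference as three terms: the mean of
  \<open>(1 - cos) * (1 - cos)\<close>, the product of the two means of \<open>1 - cos\<close>, and
  the mean of \<open>sin * sin\<close>. In each, one factor is at most
  \<open>r * \<bar>s\<bar>\<close> and the other at most \<open>r * \<bar>t\<bar>\<close>, so
  \<open>?c\<close> becomes 3.\<close>
schematic_goal chf_add: "\<bar>chf (s + t) - chf s * chf t\<bar> \<le> ?c * r\<^sup>2 * \<bar>s * t\<bar>"
proof -
  have int_cos: "integrable \<mu> (\<lambda>u. cos (q * u))" for q
    by (rule integrable_\<mu>_if_bounded[where B=1]) auto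
  have le1: "\<bar>x * y\<bar> \<le> 1" if "\<bar>x\<bar> \<le> 1" "\<bar>y\<bar> \<le> 1" for x y :: real
    using that mult_le_one[of "\<bar>x\<bar>" "\<bar>y\<bar>"] by (simp add: abs_mult)
  have int_cc: "integrable \<mu> (\<lambda>u. cos (s * u) * cos (t * u))"
    by (rule integrable_\<mu>_if_bounded[where B=1]) (auto intro!: le1)
  have int_ss: "integrable \<mu> (\<lambda>u. sin (s * u) * sin (t * u))"
    by (rule integrable_\<mu>_if_bounded[where B=1]) (auto intro!: le1)
  have small: "0 \<le> 1 - cos (q * u)" "1 - cos (q * u) \<le> r * \<bar>q\<bar>" "\<bar>sin (q * u)\<bar> \<le> r * \<bar>q\<bar>"
    if "\<bar>u\<bar> \<le> r" for q u
    using one_minus_cos_le_abs[of "q * u"] abs_sin_x_le_abs_x[of "q * u"]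
      mult_left_mono[OF that, of "\<bar>q\<bar>"]
    by (simp_all add: abs_mult mult.commute)
  have mean: "0 \<le> 1 - chf q" "1 - chf q \<le> r * \<bar>q\<bar>" for q
  proof -
    have eq: "1 - chf q = (\<integral>u. 1 - cos (q * u) \<partial>\<mu>)"
      unfolding chf_def using int_cos by simp
    show "0 \<le> 1 - chf q"
      using chf_abs_le[of q] by simp
    have "(\<integral>u. 1 - cos (q * u) \<partial>\<mu>) \<le> (\<integral>u. r * \<bar>q\<bar> \<partial>\<mu>)"
      using bounded
      by (intro integral_mono_AE) (auto simp: int_cos small elim: eventually_mono)
    then show "1 - chf q \<le> r * \<bar>q\<bar>"
      using eq by simp
  qed
  have I: "\<bar>\<integral>u. (1 - cos (s * u)) * (1 - cos (t * u)) \<partial>\<mu>\<bar> \<le> (r * \<bar>s\<bar>) * (r * \<bar>t\<bar>)"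
    (is "\<bar>?I\<bar> \<le> _")
    by (rule abs_integral_le_const) (use small r_pos in \<open>auto simp: abs_mult intro!: mult_mono\<close>)
  have J: "\<bar>\<integral>u. sin (s * u) * sin (t * u) \<partial>\<mu>\<bar> \<le> (r * \<bar>s\<bar>) * (r * \<bar>t\<bar>)"
    (is "\<bar>?J\<bar> \<le> _")
    by (rule abs_integral_le_const) (use small r_pos in \<open>auto simp: abs_mult intro!: mult_mono\<close>)
  have P: "\<bar>(1 - chf s) * (1 - chf t)\<bar> \<le> (r * \<bar>s\<bar>) * (r * \<bar>t\<bar>)"
    using mean r_pos by (auto simp: abs_mult intro!: mult_mono)
  have eq: "chf (s + t) - chf s * chf t = ?I - (1 - chf s) * (1 - chf t) - ?J"
  proof -
    have "chf (s + t) = (\<integral>u. cos (s * u) * cos (t * u) \<partial>\<mu>) - ?J"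
      unfolding chf_def using int_cc int_ss by (simp add: distrib_right cos_add)
    moreover have "?I = 1 - chf s - chf t + (\<integral>u. cos (s * u) * cos (t * u) \<partial>\<mu>)"
    proof -
      have "?I = (\<integral>u. 1 - cos (s * u) - cos (t * u) + cos (s * u) * cos (t * u) \<partial>\<mu>)"
        by (simp add: algebra_simps)
      then show ?thesis
        using int_cos int_cc by (simp add: chf_def)
    qed
    ultimately show ?thesis by (simp add: algebra_simps)
  qed
  have "\<bar>x - y - z\<bar> \<le> 3 * c" if "\<bar>x\<bar> \<le> c" "\<bar>y\<bar> \<le> c" "\<bar>z\<bar> \<le> c" for x y z c :: real
    using that by linarith
  from this[OF I P J] have "\<bar>chf (s + t) - chf s * chf t\<bar> \<le> 3 * ((r * \<bar>s\<bar>) * (r * \<bar>t\<bar>))"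
    by (simp only: eq)
  also have "\<dots> = 3 * r\<^sup>2 * \<bar>s * t\<bar>"
    by (simp add: power2_eq_square abs_mult)
  finally show "\<bar>chf (s + t) - chf s * chf t\<bar> \<le> 3 * r\<^sup>2 * \<bar>s * t\<bar>" .
qed

text \<open>This permits multiplying upper bounds factor by factor in
  \<open>expectation_cos_lin_le\<close>. It holds because \<open>t * u\<close> stays in [-1,1],
  where the cosine is nonnegative.\<close>

lemma chf_nonneg:
  assumes "r * \<bar>t\<bar> \<le> 1"
  shows "0 \<le> chf t"
  unfolding chf_def
proof (rule integral_nonneg_AE)
  show "AE u in \<mu>. 0 \<le> cos (t * u)"
    using bounded
  proof eventually_elim
    case (elim u)
    have "\<bar>t * u\<bar> \<le> 1"
      using mult_left_mono[OF elim, of "\<bar>t\<bar>"] assms by (simp add: abs_mult mult.commute)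
    then show ?case
      using pi_ge_two by (intro cos_ge_zero) auto
  qed
qed

lemma chf_le:
  assumes "r * \<bar>t\<bar> \<le> 1"
  shows "chf t \<le> exp (- (11 / 24 * t\<^sup>2 * (\<integral>u. u\<^sup>2 \<partial>\<mu>)))"
proof -
  have "chf t \<le> (\<integral>u. 1 - 11 / 24 * t\<^sup>2 * u\<^sup>2 \<partial>\<mu>)"
    unfolding chf_def
  proof (rule integral_mono_AE)
    show "AE u in \<mu>. cos (t * u) \<le> 1 - 11 / 24 * t\<^sup>2 * u\<^sup>2"
      using bounded
    proof eventually_elim
      case (elim u)
      have "\<bar>t * u\<bar> \<le> 1"
        using mult_left_mono[OF elim, of "\<bar>t\<bar>"] assms by (simp add: abs_mult mult.commute)
      then show ?case
        using cos_le_one_minus_square[of "t * u"] by (simp add: power_mult_distrib)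
    qed
    show "integrable \<mu> (\<lambda>u. cos (t * u))"
      by (rule integrable_\<mu>_if_bounded[where B=1]) auto
  qed (use integrable_square in simp)
  also have "\<dots> = 1 + - (11 / 24 * t\<^sup>2 * (\<integral>u. u\<^sup>2 \<partial>\<mu>))"
    using integrable_square by simp
  also have "\<dots> \<le> exp (- (11 / 24 * t\<^sup>2 * (\<integral>u. u\<^sup>2 \<partial>\<mu>)))"
    by (rule exp_ge_add_one_self)
  finally show ?thesis .
qed

lemma expectation_cos_lin_le:
  assumes "\<And>j. j \<le> d \<Longrightarrow> r * \<bar>c j\<bar> \<le> 1"
  shows "(\<integral>a. cos (lin c a) \<partial>joint) \<le> exp (- (11 / 24 * (\<integral>u. u\<^sup>2 \<partial>\<mu>) * (\<Sum>j\<le>d. (c j)\<^sup>2)))"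
proof -
  have "(\<Prod>j\<le>d. chf (c j)) \<le> (\<Prod>j\<le>d. exp (- (11 / 24 * (c j)\<^sup>2 * (\<integral>u. u\<^sup>2 \<partial>\<mu>))))"
    using assms chf_nonneg chf_le by (intro prod_mono) blast
  also have "\<dots> = exp (- (11 / 24 * (\<integral>u. u\<^sup>2 \<partial>\<mu>) * (\<Sum>j\<le>d. (c j)\<^sup>2)))"
    by (simp add: exp_sum[symmetric] sum_distrib_left sum_negf mult_ac)
  finally show ?thesis by (simp add: expectation_cos_lin)
qed

lemma integrable_cos_lin: "integrable joint (\<lambda>a. cos (lin c a))"
  by (rule integrable_joint_if_bounded[where B=1]) auto

\<comment> \<open>The product of cosines is the average of the cosines of sum and difference. Their
  expectations are products of numbers of modulus at most 1, so replacing \<open>chf (c + e)\<close>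
  by \<open>chf c * chf e\<close> costs at most the sum of the errors in \<open>chf_add\<close>.
  Averaging over \<open>e = c'\<close> and \<open>e = - c'\<close> keeps the constant 3.\<close>
schematic_goal covariance_cos_lin:
  "\<bar>(\<integral>a. cos (lin c a) * cos (lin c' a) \<partial>joint) -
    (\<integral>a. cos (lin c a) \<partial>joint) * (\<integral>a. cos (lin c' a) \<partial>joint)\<bar>
   \<le> ?K * r\<^sup>2 * (\<Sum>j\<le>d. \<bar>c j * c' j\<bar>)"
proof -
  let ?E = "\<lambda>c. (\<integral>a. cos (lin c a) \<partial>joint)"
  have *: "\<bar>?E (\<lambda>j. c j + e j) - ?E c * ?E e\<bar> \<le> 3 * r\<^sup>2 * (\<Sum>j\<le>d. \<bar>c j * e j\<bar>)" for e
  proof -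
    have "\<bar>?E (\<lambda>j. c j + e j) - ?E c * ?E e\<bar> =
        norm ((\<Prod>j\<le>d. chf (c j + e j)) - (\<Prod>j\<le>d. chf (c j) * chf (e j)))"
      by (simp add: expectation_cos_lin prod.distrib)
    also have "\<dots> \<le> (\<Sum>j\<le>d. norm (chf (c j + e j) - chf (c j) * chf (e j)))"
      by (rule norm_prod_diff) (auto simp: chf_abs_le abs_mult intro!: mult_le_one)
    also have "\<dots> \<le> (\<Sum>j\<le>d. 3 * r\<^sup>2 * \<bar>c j * e j\<bar>)"
      using chf_add by (intro sum_mono) simp
    finally show ?thesis by (simp add: sum_distrib_left)
  qed
  have even: "?E (\<lambda>j. - c' j) = ?E c'"
    by (simp add: lin_uminus)
  have "(\<integral>a. cos (lin c a) * cos (lin c' a) \<partial>joint) =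
      (\<integral>a. (cos (lin (\<lambda>j. c j + c' j) a) + cos (lin (\<lambda>j. c j + - c' j) a)) / 2 \<partial>joint)"
    by (intro Bochner_Integration.integral_cong refl)
       (simp only: lin_add lin_uminus, simp add: cos_add cos_diff)
  also have "\<dots> = (?E (\<lambda>j. c j + c' j) + ?E (\<lambda>j. c j + - c' j)) / 2"
    by (simp only: Bochner_Integration.integral_divide_zero Bochner_Integration.integral_add integrable_cos_lin)
  finally show "\<bar>(\<integral>a. cos (lin c a) * cos (lin c' a) \<partial>joint) -
          (\<integral>a. cos (lin c a) \<partial>joint) * (\<integral>a. cos (lin c' a) \<partial>joint)\<bar>
         \<le> 3 * r\<^sup>2 * (\<Sum>j\<le>d. \<bar>c j * c' j\<bar>)"
    using *[of c'] *[of "\<lambda>j. - c' j"] unfolding even by (simp add: abs_mult)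
qed

section \<open>Second moments of linear forms\<close>

lemma expectation_coeff_mult:
  assumes "i \<le> d" "j \<le> d"
  shows "integrable joint (\<lambda>a. a i * a j)"
    and "(\<integral>a. a i * a j \<partial>joint) = (if i = j then \<integral>u. u\<^sup>2 \<partial>\<mu> else 0)"
proof -
  \<comment> \<open>\<open>a i * a j\<close> is written as a product over all indices, so that
    independence covers \<open>i = j\<close> and \<open>i \<noteq> j\<close> alike.\<close>
  let ?f = "\<lambda>l u. (if l = i then u else 1) * (if l = j then u else 1 :: real)"
  have id: "integrable \<mu> (\<lambda>u. u)"
    by (rule integrable_bounded_AE[where B=r]) auto
  have sq: "integrable \<mu> (\<lambda>u. u * u)"
    using integrable_square by (simp add: power2_eq_square)
  have int: "integrable \<mu> (?f l)" for l
    by (cases "l = i"; cases "l = j") (auto intro: id sq)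
  have eq: "(\<Prod>l\<le>d. ?f l (a l)) = a i * a j" for a :: "nat \<Rightarrow> real"
    using assms by (simp add: prod.distrib prod.delta)
  show "integrable joint (\<lambda>a. a i * a j)"
    using product_sigma_finite.product_integrable_prod[OF product_sigma_finite_\<mu>, of "{..d}" ?f, OF _ int] by (simp add: eq)
  have "(\<integral>a. a i * a j \<partial>joint) = (\<Prod>l\<le>d. integral\<^sup>L \<mu> (?f l))"
    using product_sigma_finite.product_integral_prod[OF product_sigma_finite_\<mu>, of "{..d}" ?f, OF _ int] by (simp add: eq)
  also have "\<dots> = (if i = j then \<integral>u. u\<^sup>2 \<partial>\<mu> else 0)"
  proof (cases "i = j")
    case True
    have "integral\<^sup>L \<mu> (?f l) = (if l = j then \<integral>u. u\<^sup>2 \<partial>\<mu> else 1)" for l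
      using True by (simp add: power2_eq_square)
    then show ?thesis using True assms by (simp add: prod.delta)
  next
    case False
    have "integral\<^sup>L \<mu> (?f i) = 0"
      using False by (simp add: integral_odd)
    then show ?thesis using False assms by (auto intro!: prod_zero bexI[of _ i])
  qed
  finally show "(\<integral>a. a i * a j \<partial>joint) = (if i = j then \<integral>u. u\<^sup>2 \<partial>\<mu> else 0)" .
qed

lemma second_moment_lin:
  shows "integrable joint (\<lambda>a. (lin c a)\<^sup>2)"
    and "(\<integral>a. (lin c a)\<^sup>2 \<partial>joint) \<le> r\<^sup>2 * (\<Sum>j\<le>d. (c j)\<^sup>2)"
proof -
  have sq: "(lin c a)\<^sup>2 = (\<Sum>i\<le>d. \<Sum>j\<le>d. c i * c j * (a i * a j))" for a
    by (simp add: lin_def power2_eq_square sum_product mult_ac)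
  have int: "integrable joint (\<lambda>a. c i * c j * (a i * a j))" if "i \<le> d" "j \<le> d" for i j
    using expectation_coeff_mult(1)[OF that] by simp
  show "integrable joint (\<lambda>a. (lin c a)\<^sup>2)"
    unfolding sq using int by (intro Bochner_Integration.integrable_sum) auto
  have "(\<integral>a. (lin c a)\<^sup>2 \<partial>joint) = (\<Sum>i\<le>d. \<Sum>j\<le>d. c i * c j * (\<integral>a. a i * a j \<partial>joint))"
  proof -
    have "(\<integral>a. (\<Sum>i\<le>d. \<Sum>j\<le>d. c i * c j * (a i * a j)) \<partial>joint) =
        (\<Sum>i\<le>d. \<integral>a. (\<Sum>j\<le>d. c i * c j * (a i * a j)) \<partial>joint)"
      by (intro Bochner_Integration.integral_sum Bochner_Integration.integrable_sum int) auto
    also have "\<dots> = (\<Sum>i\<le>d. \<Sum>j\<le>d. \<integral>a. c i * c j * (a i * a j) \<partial>joint)"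
      by (intro sum.cong refl Bochner_Integration.integral_sum int) auto
    finally show ?thesis
      by (simp add: sq)
  qed
  also have "\<dots> = (\<Sum>i\<le>d. \<Sum>j\<le>d. if j = i then c i * c i * (\<integral>u. u\<^sup>2 \<partial>\<mu>) else 0)"
    by (intro sum.cong refl) (auto simp: expectation_coeff_mult(2))
  also have "\<dots> = (\<integral>u. u\<^sup>2 \<partial>\<mu>) * (\<Sum>j\<le>d. (c j)\<^sup>2)"
    by (simp add: sum.delta sum_distrib_left power2_eq_square mult_ac)
  also have "\<dots> \<le> r\<^sup>2 * (\<Sum>j\<le>d. (c j)\<^sup>2)"
    using abs_integral_le_const[of "\<lambda>u. u\<^sup>2" "r\<^sup>2"]
    by (intro mult_right_mono sum_nonneg) (auto simp: abs_le_square_iff[symmetric])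
  finally show "(\<integral>a. (lin c a)\<^sup>2 \<partial>joint) \<le> r\<^sup>2 * (\<Sum>j\<le>d. (c j)\<^sup>2)" .
qed

\<comment> \<open>With \<open>m = card T\<close>, a common sign forces the modulus of the sum
  \<open>A\<close> of the forms to be at least \<open>m - B\<close>, where \<open>B\<close> is the
  sum of their cosines. As \<open>B\<close> has mean at most \<open>m - \<delta> * m\<close>, either
  \<open>A\<close> is large or \<open>B\<close> is far from its mean. Both have variance of order
  \<open>C * m\<close> against deviations of order \<open>m\<close>.\<close>
schematic_goal prob_same_sign_le:
  fixes b :: "'k \<Rightarrow> nat \<Rightarrow> real"
  assumes T: "finite T" "T \<noteq> {}"
    and nonneg: "\<And>k j. k \<in> T \<Longrightarrow> j \<le> d \<Longrightarrow> 0 \<le> b k j"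
    and small: "\<And>k j. k \<in> T \<Longrightarrow> j \<le> d \<Longrightarrow> r * b k j \<le> 1"
    and s: "0 < s" "\<And>k. k \<in> T \<Longrightarrow> s \<le> (\<integral>u. u\<^sup>2 \<partial>\<mu>) * (\<Sum>j\<le>d. (b k j)\<^sup>2)"
    and C: "\<And>k. k \<in> T \<Longrightarrow> (\<Sum>l\<in>T. r\<^sup>2 * (\<Sum>j\<le>d. b k j * b l j)) \<le> C"
  shows "measure joint {a \<in> space joint. (\<forall>k\<in>T. 0 \<le> lin (b k) a) \<or> (\<forall>k\<in>T. lin (b k) a \<le> 0)}
    \<le> ?K * C / (1 - exp (- (11 / 24 * s)))\<^sup>2 / card T"
proof -
  have finite_joint: "finite_measure joint"
    by (rule prob_space.finite_measure[OF prob_space_joint])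
  define m where "m = real (card T)"
  define \<delta> where "\<delta> = 1 - exp (- (11 / 24 * s))"
  define A where "A a = lin (\<lambda>j. \<Sum>k\<in>T. b k j) a" for a
  define B where "B a = (\<Sum>k\<in>T. cos (lin (b k) a))" for a
  have m: "0 < m" using T by (simp add: m_def card_gt_0_iff)
  have \<delta>: "0 < \<delta>" using s(1) by (simp add: \<delta>_def)
  have A_eq: "A a = (\<Sum>k\<in>T. lin (b k) a)" for a
    by (simp add: A_def lin_sum)
  have [measurable]: "A \<in> borel_measurable joint" "B \<in> borel_measurable joint"
    unfolding A_def B_def by measurable
  have corr: "(\<Sum>k\<in>T. \<Sum>l\<in>T. r\<^sup>2 * (\<Sum>j\<le>d. b k j * b l j)) \<le> C * m"
    using sum_bounded_above[of T _ C] C by (simp add: m_def mult.commute)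
  have intA: "integrable joint (\<lambda>a. (A a)\<^sup>2)"
    unfolding A_def by (rule second_moment_lin)
  have "(\<integral>a. (A a)\<^sup>2 \<partial>joint) \<le> r\<^sup>2 * (\<Sum>j\<le>d. (\<Sum>k\<in>T. b k j)\<^sup>2)"
    unfolding A_def by (rule second_moment_lin)
  also have "(\<Sum>j\<le>d. (\<Sum>k\<in>T. b k j)\<^sup>2) = (\<Sum>k\<in>T. \<Sum>l\<in>T. \<Sum>j\<le>d. b k j * b l j)"
    by (simp add: power2_eq_square sum_product sum.swap[of _ "{..d}" T])
  also have "r\<^sup>2 * \<dots> \<le> C * m"
    using corr by (simp add: sum_distrib_left)
  finally have momA: "(\<integral>a. (A a)\<^sup>2 \<partial>joint) \<le> C * m" .

  have intB: "integrable joint B"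
    unfolding B_def by (intro Bochner_Integration.integrable_sum integrable_cos_lin)
  have int2: "integrable joint (\<lambda>a. cos (lin c a) * cos (lin c' a))" for c c'
    by (rule integrable_joint_if_bounded[where B=1])
       (auto simp: abs_mult intro!: AE_I2 mult_le_one)
  have B2: "(B a)\<^sup>2 = (\<Sum>k\<in>T. \<Sum>l\<in>T. cos (lin (b k) a) * cos (lin (b l) a))" for a
    by (simp add: B_def power2_eq_square sum_product)
  have intB2: "integrable joint (\<lambda>a. (B a)\<^sup>2)"
    unfolding B2 by (intro Bochner_Integration.integrable_sum int2)
  let ?E = "\<lambda>k. (\<integral>a. cos (lin (b k) a) \<partial>joint)"
  have EB: "(\<integral>a. B a \<partial>joint) = (\<Sum>k\<in>T. ?E k)"
    unfolding B_def by (rule Bochner_Integration.integral_sum) (rule integrable_cos_lin)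
  let ?V = "\<integral>a. (B a - (\<integral>a. B a \<partial>joint))\<^sup>2 \<partial>joint"
  have "?V = (\<integral>a. (B a)\<^sup>2 \<partial>joint) - (\<integral>a. B a \<partial>joint)\<^sup>2"
    by (rule prob_space.variance_eq[OF prob_space_joint]) (rule intB intB2)+
  also have "(\<integral>a. (B a)\<^sup>2 \<partial>joint) =
      (\<Sum>k\<in>T. \<Sum>l\<in>T. \<integral>a. cos (lin (b k) a) * cos (lin (b l) a) \<partial>joint)"
    unfolding B2 by (simp add: Bochner_Integration.integral_sum int2)
  also have "\<dots> - (\<integral>a. B a \<partial>joint)\<^sup>2 =
      (\<Sum>k\<in>T. \<Sum>l\<in>T. (\<integral>a. cos (lin (b k) a) * cos (lin (b l) a) \<partial>joint) - ?E k * ?E l)"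
    by (simp add: EB power2_eq_square sum_product sum_subtractf)
  also have "\<dots> \<le> (\<Sum>k\<in>T. \<Sum>l\<in>T. 3 * (r\<^sup>2 * (\<Sum>j\<le>d. b k j * b l j)))"
  proof (intro sum_mono)
    fix k l assume "k \<in> T" "l \<in> T"
    \<comment> \<open>Nonnegative weights turn the sum of absolute values in the covariance bound
      into the correlation controlled by \<open>C\<close>.\<close>
    then have "(\<Sum>j\<le>d. \<bar>b k j * b l j\<bar>) = (\<Sum>j\<le>d. b k j * b l j)"
      by (intro sum.cong) (simp_all add: nonneg)
    then show "(\<integral>a. cos (lin (b k) a) * cos (lin (b l) a) \<partial>joint) - ?E k * ?E l
        \<le> 3 * (r\<^sup>2 * (\<Sum>j\<le>d. b k j * b l j))"
      using covariance_cos_lin[of "b k" "b l"] by simp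
  qed
  also have "\<dots> \<le> 3 * (C * m)"
    using corr by (simp add: sum_distrib_left[symmetric])
  finally have varB: "?V \<le> 3 * (C * m)" .

  have "(\<integral>a. B a \<partial>joint) \<le> (\<Sum>k\<in>T. 1 - \<delta>)"
    unfolding EB
  proof (rule sum_mono)
    fix k assume k: "k \<in> T"
    have "?E k \<le> exp (- (11 / 24 * (\<integral>u. u\<^sup>2 \<partial>\<mu>) * (\<Sum>j\<le>d. (b k j)\<^sup>2)))"
      using nonneg small k by (intro expectation_cos_lin_le) simp
    also have "\<dots> \<le> 1 - \<delta>"
      using s(2)[OF k] by (simp add: \<delta>_def)
    finally show "?E k \<le> 1 - \<delta>" .
  qed
  then have meanB: "(\<integral>a. B a \<partial>joint) \<le> m - \<delta> * m"
    by (simp add: m_def algebra_simps)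

  \<comment> \<open>Half of the gap \<open>\<delta> * m\<close>: one half is left to the fluctuation
    of \<open>B\<close>, the other is what \<open>A\<close> must then exceed.\<close>
  define \<epsilon> where "\<epsilon> = \<delta> * m / 2"
  have \<epsilon>: "0 < \<epsilon>" using \<delta> m by (simp add: \<epsilon>_def)
  let ?UA = "{a \<in> space joint. \<epsilon> \<le> \<bar>A a\<bar>}"
  let ?UB = "{a \<in> space joint. \<epsilon> \<le> \<bar>B a - (\<integral>a. B a \<partial>joint)\<bar>}"
  have sub: "{a \<in> space joint. (\<forall>k\<in>T. 0 \<le> lin (b k) a) \<or> (\<forall>k\<in>T. lin (b k) a \<le> 0)} \<subseteq> ?UA \<union> ?UB"
  proof safe
    fix a assume a: "a \<in> space joint" and nB: "\<not> \<epsilon> \<le> \<bar>B a - (\<integral>a. B a \<partial>joint)\<bar>"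
    have "m - B a = (\<Sum>k\<in>T. 1 - cos (lin (b k) a))"
      by (simp add: m_def B_def sum_subtractf)
    also have "\<dots> \<le> (\<Sum>k\<in>T. \<bar>lin (b k) a\<bar>)"
      by (intro sum_mono one_minus_cos_le_abs)
    finally have "m - B a \<le> (\<Sum>k\<in>T. \<bar>lin (b k) a\<bar>)" .
    moreover have "B a < (\<integral>a. B a \<partial>joint) + \<epsilon>"
      using nB by linarith
    moreover have "m - \<delta> * m = m - \<epsilon> - \<epsilon>"
      by (simp add: \<epsilon>_def)
    ultimately have *: "\<epsilon> \<le> (\<Sum>k\<in>T. \<bar>lin (b k) a\<bar>)"
      using meanB by linarith
    show "\<epsilon> \<le> \<bar>A a\<bar>" if "\<forall>k\<in>T. 0 \<le> lin (b k) a"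
      using * that by (simp add: A_eq)
    show "\<epsilon> \<le> \<bar>A a\<bar>" if "\<forall>k\<in>T. lin (b k) a \<le> 0"
      using * that by (simp add: A_eq sum_negf abs_of_nonpos)
  qed
  have "measure joint {a \<in> space joint. (\<forall>k\<in>T. 0 \<le> lin (b k) a) \<or> (\<forall>k\<in>T. lin (b k) a \<le> 0)}
      \<le> measure joint (?UA \<union> ?UB)"
    by (rule finite_measure.finite_measure_mono[OF finite_joint sub]) measurable
  also have "\<dots> \<le> measure joint ?UA + measure joint ?UB"
    by (rule measure_Un_le) measurable
  \<comment> \<open>\<open>A\<close> contributes variance \<open>C * m\<close> and \<open>B\<close>
    contributes \<open>3 * C * m\<close>; division by \<open>\<epsilon>^2\<close> gives the factor
    16 below.\<close>
  also have "\<dots> \<le> C * m / \<epsilon>\<^sup>2 + 3 * (C * m) / \<epsilon>\<^sup>2"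
    using finite_measure.second_moment_method[OF finite_joint _ intA \<epsilon>] prob_space.Chebyshev_inequality[OF prob_space_joint _ intB2 \<epsilon>]
      divide_right_mono[OF momA, of "\<epsilon>\<^sup>2"] divide_right_mono[OF varB, of "\<epsilon>\<^sup>2"]
    by (intro add_mono) (auto intro: order_trans)
  also have "\<dots> = 16 * C / \<delta>\<^sup>2 / m"
    using m \<delta> by (simp add: \<epsilon>_def power2_eq_square field_simps)
  finally show "measure joint {a \<in> space joint. (\<forall>k\<in>T. 0 \<le> lin (b k) a) \<or> (\<forall>k\<in>T. lin (b k) a \<le> 0)}
      \<le> 16 * C / (1 - exp (- (11 / 24 * s)))\<^sup>2 / card T"
    by (simp add: \<delta>_def m_def)
qed

end

section \<open>The probability of g-convexity\<close>

lemma bounded_symmetric_uniform: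
  assumes "0 < r"
  shows "bounded_symmetric_coefficients (uniform_measure lborel {-r..r}) r"
proof -
  let ?\<mu> = "uniform_measure lborel {-r..r}"
  show ?thesis
  proof (rule bounded_symmetric_coefficients.intro)
    show "prob_space ?\<mu>" by (rule prob_space_uniform_Icc[OF assms])
    show "sets ?\<mu> = sets borel" by simp
    show "AE u in ?\<mu>. \<bar>u\<bar> \<le> r"
      by (rule AE_uniform_measureI) auto
    show "distr ?\<mu> borel uminus = ?\<mu>"
    proof (rule measure_eqI)
      fix A assume "A \<in> sets (distr ?\<mu> borel uminus)"
      then have A [measurable]: "A \<in> sets borel" by simp
      have [measurable]: "uminus -` A \<in> sets borel"
        using measurable_sets_borel[of uminus borel A] by simp
      have "{-r..r} \<inter> uminus -` A = uminus -` ({-r..r} \<inter> A)"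
        by auto
      then have "emeasure lborel ({-r..r} \<inter> uminus -` A) = emeasure (distr lborel borel uminus) ({-r..r} \<inter> A)"
        by (simp add: emeasure_distr)
      also have "\<dots> = emeasure lborel ({-r..r} \<inter> A)"
        by (simp add: lborel_distr_uminus)
      finally show "emeasure (distr ?\<mu> borel uminus) A = emeasure ?\<mu> A"
        by (simp add: emeasure_distr)
    qed simp
  qed (rule assms)
qed

text \<open>A positive value in the left block and a negative one in the right block would make the
  sign drop, so one of the blocks has a constant sign wherever the sign change lies.\<close>

lemma mono_sgn_same_sign:
  fixes p x :: "_ \<Rightarrow> real"
  assumes mono: "mono (\<lambda>x. sgn (p x))" and lt: "\<And>k l. k \<in> S \<Longrightarrow> l \<in> T \<Longrightarrow> x k \<le> x l"
  shows "(\<forall>k\<in>S. p (x k) \<le> 0) \<or> (\<forall>l\<in>T. 0 \<le> p (x l))"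
proof (rule ccontr)
  assume "\<not> ?thesis"
  then obtain k l where "k \<in> S" "0 < p (x k)" "l \<in> T" "p (x l) < 0"
    by (auto simp: not_le)
  then show False
    using monoD[OF mono lt, of k l] by (simp add: sgn_if)
qed

schematic_goal prob_g_convexifiable_le:
  assumes r: "0 < r" and n: "1 \<le> n" "16 ^ n \<le> d"
  shows "measure (coeff_distr d r) (g_convexifiable d r) \<le> ?K / real n"
proof -
  let ?joint = "Pi\<^sub>M {..d} (\<lambda>_. uniform_measure lborel {-r..r})"
  let ?lin = "bounded_symmetric_coefficients.lin d"
  note unif = bounded_symmetric_uniform[OF r]
  note [measurable] = bounded_symmetric_coefficients.lin_measurable[OF unif]
  have fin_joint: "finite_measure ?joint"
    by (rule prob_space.finite_measure[OF bounded_symmetric_coefficients.prob_space_joint[OF unif]])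
  have distr: "coeff_distr d r = ?joint"
    by (rule coeff_distr_eq_PiM[OF r])
  let ?S = "\<lambda>T. {a \<in> space ?joint. (\<forall>k\<in>T. 0 \<le> ?lin (weight r k) a) \<or> (\<forall>k\<in>T. ?lin (weight r k) a \<le> 0)}"
  have lin: "?lin (weight r k) a = poly (pderiv (coeff_poly d a)) (node k) / (2 * r * 8 ^ k)" for k a
    by (simp add: bounded_symmetric_coefficients.lin_def[OF unif] weight_def poly_pderiv_coeff_poly sum_divide_distrib)
  have bound: "measure ?joint (?S T) \<le> 32 / (1 - exp (- (11 / 24 * (1 / 4608))))\<^sup>2 / real n"
    if T: "T \<subseteq> {1..2 * n}" "card T = n" for T
  proof -
    have fin: "finite T" "T \<noteq> {}"
      using T n(1) finite_subset by auto
    have "measure ?joint (?S T) \<le> 16 * 2 / (1 - exp (- (11 / 24 * (1 / 4608))))\<^sup>2 / card T"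
    proof (rule bounded_symmetric_coefficients.prob_same_sign_le[OF unif fin])
      fix k assume "k \<in> T"
      then have k: "1 \<le> k" "k \<le> 2 * n" using T(1) by auto
      \<comment> \<open>The degree must resolve the scale of the last node: \<open>k\<close> runs up
        to \<open>2 * n\<close>, hence the requirement \<open>16 ^ n \<le> d\<close>.\<close>
      have "(4::nat) ^ (k - 1) \<le> 4 ^ (2 * n)"
        using k by (intro power_increasing) auto
      also have "\<dots> = 16 ^ n"
        by (simp add: power_mult)
      also have "\<dots> \<le> d" by (rule n(2))
      finally show "1 / 4608 \<le> (\<integral>u. u\<^sup>2 \<partial>uniform_measure lborel {-r..r}) * (\<Sum>j\<le>d. (weight r k j)\<^sup>2)"
        unfolding second_moment_uniform[OF r] using weight_norm_ge[OF r k(1)] by blast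
      have "(\<Sum>l\<in>T. r\<^sup>2 * (\<Sum>j\<le>d. weight r k j * weight r l j)) \<le>
          (\<Sum>l\<in>T. (1 / 8) ^ (max k l - min k l) / 2)"
        by (intro sum_mono weight_inner_le r)
      \<comment> \<open>The geometric bound with ratio 1/8 gives \<open>8/7\<close>; the value 2 is
        the row bound \<open>C\<close>.\<close>
      also have "\<dots> \<le> 2"
        using sum_geometric_dist_le[OF fin(1), of "1 / 8" k] by (simp add: sum_divide_distrib[symmetric])
      finally show "(\<Sum>l\<in>T. r\<^sup>2 * (\<Sum>j\<le>d. weight r k j * weight r l j)) \<le> 2" .
    qed (use r in \<open>auto intro: weight_nonneg weight_small\<close>)
    then show ?thesis using T(2) by simp
  qed
  have "g_convexifiable d r \<subseteq> ?S {1..n} \<union> ?S {n + 1..2 * n}"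
  proof
    fix a assume a: "a \<in> g_convexifiable d r"
    have "a \<in> space ?joint"
      using subsetD[OF sets.sets_into_space[OF g_convexifiable_sets] a] by (simp only: distr)
    moreover have "(\<forall>k\<in>{1..n}. poly (pderiv (coeff_poly d a)) (node k) \<le> 0) \<or>
        (\<forall>l\<in>{n + 1..2 * n}. 0 \<le> poly (pderiv (coeff_poly d a)) (node l))"
      using a strict_mono_node
      by (intro mono_sgn_same_sign) (auto simp: g_convexifiable_eq strict_mono_less_eq)
    ultimately show "a \<in> ?S {1..n} \<union> ?S {n + 1..2 * n}"
      using r by (auto simp: lin divide_le_0_iff)
  qed
  then have "measure ?joint (g_convexifiable d r) \<le> measure ?joint (?S {1..n} \<union> ?S {n + 1..2 * n})"
    by (rule finite_measure.finite_measure_mono[OF fin_joint]) measurable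
  also have "\<dots> \<le> measure ?joint (?S {1..n}) + measure ?joint (?S {n + 1..2 * n})"
    by (rule measure_Un_le) measurable
  \<comment> \<open>Each block costs \<open>16 * 2 = 32\<close>; the two blocks together give
    64.\<close>
  also have "\<dots> \<le> 32 / (1 - exp (- (11 / 24 * (1 / 4608))))\<^sup>2 / real n +
      32 / (1 - exp (- (11 / 24 * (1 / 4608))))\<^sup>2 / real n"
    by (intro add_mono bound) auto
  finally show "measure (coeff_distr d r) (g_convexifiable d r) \<le>
      64 / (1 - exp (- (11 / 24 * (1 / 4608))))\<^sup>2 / real n"
    by (simp add: distr mult.commute)
qed

theorem theorem5p12:
  fixes r :: real
  assumes "r > 0"
  shows "(\<forall>d\<ge>1. g_convexifiable d r \<in> sets (coeff_distr d r)) \<and>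
         (\<lambda>d. measure (coeff_distr d r) (g_convexifiable d r)) \<in> O(\<lambda>d. 1 / ln (real d))"
proof
  show "\<forall>d\<ge>1. g_convexifiable d r \<in> sets (coeff_distr d r)"
    using g_convexifiable_sets by blast
  define K where "K = 64 / (1 - exp (- (11 / 24 * (1 / 4608 :: real))))\<^sup>2"
  have "0 \<le> K" by (simp add: K_def)
  show "(\<lambda>d. measure (coeff_distr d r) (g_convexifiable d r)) \<in> O(\<lambda>d. 1 / ln (real d))"
  proof (rule bigoI[where c = "K * (2 * ln 16)"])
    show "\<forall>\<^sub>F d in sequentially. norm (measure (coeff_distr d r) (g_convexifiable d r)) \<le>
        K * (2 * ln 16) * norm (1 / ln (real d))"
    proof (rule eventually_sequentiallyI)
      fix d :: nat assume d: "16 \<le> d"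
      \<comment> \<open>The largest block length for which \<open>16 ^ n \<le> d\<close>.\<close>
      define n where "n = nat \<lfloor>log 16 (real d)\<rfloor>"
      have log: "1 \<le> log 16 (real d)"
        using d by (simp add: le_log_iff)
      then have n: "1 \<le> n" by (simp add: n_def le_nat_iff le_floor_iff)
      have "real n \<le> log 16 (real d)"
        using log by (simp add: n_def)
      then have "16 powr real n \<le> real d"
        using d by (simp add: le_log_iff)
      then have "real (16 ^ n) \<le> real d"
        by (simp add: powr_realpow)
      then have nd: "16 ^ n \<le> d" by (simp only: of_nat_le_iff)
      \<comment> \<open>Rounding down costs at most a factor 2, because the logarithm is below
        \<open>n + 1\<close> and \<open>1 \<le> n\<close>.\<close>
      have "log 16 (real d) \<le> 2 * real n"
        using log n unfolding n_def by linarith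
      then have "ln (real d) \<le> 2 * ln 16 * real n"
        by (simp add: log_def field_simps)
      moreover have "0 < ln (real d)" using d by simp
      ultimately have "1 / real n \<le> 2 * ln 16 / ln (real d)"
        using n by (simp add: field_simps)
      then have "K * (1 / real n) \<le> K * (2 * ln 16 / ln (real d))"
        using \<open>0 \<le> K\<close> by (rule mult_left_mono)
      moreover have "measure (coeff_distr d r) (g_convexifiable d r) \<le> K * (1 / real n)"
        using prob_g_convexifiable_le[OF assms n nd] by (simp add: K_def mult.commute)
      ultimately show "norm (measure (coeff_distr d r) (g_convexifiable d r)) \<le>
          K * (2 * ln 16) * norm (1 / ln (real d))"
        using \<open>0 < ln (real d)\<close> by simp
    qed
  qed
qed

end
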